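(* There is a numerical constant $C$ with the following property. Let $(f_n)_{n\in\mathbb N}$ be a sequence in $H^1(dm)$ and let $t>0$. Assume that for all subsets $E\subset\mathbb N$ and all measurable subsets $F\subset\mathbb T$, $$\sum_{n\in E}\int_F|f_n|\,dm\le |E|\vee t^{-1}m(F).$$ Then there is a decomposition $f_n=g_n+h_n$ with $g_n\in H^1(dm)$, $h_n\in H^\infty(dm)$, such that $$\sup_{n\in\mathbb N}\|g_n\|_{H^1(dm)}\le C\quad\text{and}\quad\Big\|\sum_{n\in\mathbb N}|h_n|\Big\|_{L^\infty(dm)}\le C\,t^{-1}.$$
   Context: $\mathbb T$ is the unit circle with normalized Lebesgue measure $m$. For $1\le p\le\infty$, $H^p(dm)$ is the subspace of $L^p(dm)$ of functions $f$ with Fourier coefficients $\hat f(k)=0$ for all $k<0$. $|E|$ is the cardinality of $E$, and $u\vee v=\max(u,v)$. *)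

theory Defs
  imports "HOL-Analysis.Analysis"
begin

text \<open>The unit circle T is parametrised by [0,1] via x \<mapsto> exp(2 pi i x);
  normalized Lebesgue measure m on T becomes Lebesgue measure on [0,1].\<close>

definition circ :: "real measure" where
  "circ = lebesgue_on {0..1}"

definition fourier_coeff :: "(real \<Rightarrow> complex) \<Rightarrow> int \<Rightarrow> complex" where
  "fourier_coeff f k = (\<integral>x. f x * exp (- (2 * pi * \<i> * of_int k * of_real x)) \<partial>circ)"

definition H1 :: "(real \<Rightarrow> complex) set" where
  "H1 = {f. integrable circ f \<and> (\<forall>k<0. fourier_coeff f k = 0)}"

definition Hinf :: "(real \<Rightarrow> complex) set" where
  "Hinf = {f. f \<in> borel_measurable circ \<and> (\<exists>B. AE x in circ. norm (f x) \<le> B)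
              \<and> (\<forall>k<0. fourier_coeff f k = 0)}"

definition H1_norm :: "(real \<Rightarrow> complex) \<Rightarrow> real" where
  "H1_norm f = (\<integral>x. norm (f x) \<partial>circ)"

end

theory Submission
  imports Defs "HOL-Computational_Algebra.Polynomial"
begin

text \<open>
  By the minimax principle it suffices to bound, for all weights \<open>x\<^sub>n \<ge> 0\<close> and \<open>y \<ge> 0\<close>, the minimum
  over analytic \<open>h\<^sub>n\<close> of \<open>\<Sum>x\<^sub>n \<parallel>f\<^sub>n - h\<^sub>n\<parallel>\<^sub>1 + \<integral>y \<Sum>|h\<^sub>n|\<close> by a multiple of \<open>\<Sum>x\<^sub>n + \<integral>y / t\<close>; this
  problem decouples in \<open>n\<close>. Let \<open>Y\<close> be analytic with real part \<open>\<surd>y\<close>, so that \<open>y \<le> |Y|\<^sup>2\<close> and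
  \<open>\<integral>|Y|\<^sup>2 \<le> 4 \<integral>y\<close>. With \<open>\<phi> = \<surd>x\<^sub>n / (\<surd>x\<^sub>n + Y)\<close> and \<open>\<psi> = 1 - (1 - \<phi>\<^sup>2)\<^sup>2\<close> the bounded analytic function
  \<open>\<psi>\<close> satisfies \<open>|\<psi>| |Y|\<^sup>2 \<le> 3 min(x\<^sub>n, |Y|\<^sup>2)\<close> and \<open>x\<^sub>n |1 - \<psi>| \<le> 4 min(x\<^sub>n, |Y|\<^sup>2)\<close>, and \<open>h\<^sub>n = \<psi> f\<^sub>n\<close>
  works because the hypothesis implies
  \<open>\<Sum>\<integral>|f\<^sub>n| min(x\<^sub>n, y) \<le> \<Sum>x\<^sub>n + \<integral>y / t\<close>.
  The minimax step is carried out by nearly minimising a quadratic penalty for exceeding the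
  desired bounds, whose derivative provides the weights; the passage to the limit uses the
  parallelogram law to select an \<open>L\<^sup>2\<close>-Cauchy sequence from decreasing convex sets.
\<close>

subsection \<open>Hardy spaces and their multipliers\<close>

text \<open>The weight y is only integrable, and the conjugate function is unbounded on L^1; taking
  the square root moves the weight into L^2, where it is bounded. The cutoffs must then decay
  quadratically: \<psi> has a double zero at \<phi> = 0 and 1 - \<psi> has one at \<phi> = 1, to
  compensate |Y|^2 and x_n. A second obstacle is that \<psi> f_n may be unbounded where y is small,
  f_n being only integrable. A small multiple of the sum of the |f_n| is therefore added to y; this
  bounds the new family at the price of an error that vanishes with the multiple. Constants: 7 = 4 +
  3 from the two cutoff bounds, 28 = 7 * 4 with the loss in passing from y to |Y|^2, and 29 as a
  number above 28. The square in the penalty serves twice: it makes the penalty differentiable with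
  a multiple of the excess as derivative, and it bounds every h_n in L^2 uniformly in the number of
  functions, which the Hilbert space limit consumes.\<close>

lemma space_circ [simp]: "space circ = {0..1}"
  by (simp add: circ_def)

lemma emeasure_circ_space: "emeasure circ {0..1} = 1"
  by (simp add: circ_def emeasure_restrict_space)

lemma finite_measure_circ: "finite_measure circ"
  by (rule finite_measureI) (simp add: emeasure_circ_space)

interpretation circ: finite_measure circ
  by (rule finite_measure_circ)

lemma measure_circ_space [simp]: "measure circ {0..1} = 1"
  by (simp add: measure_def emeasure_circ_space)

lemma integral_circ_const [simp]: "(\<integral>x. c \<partial>circ) = (c :: 'a :: {banach, second_countable_topology})"
  by simp

lemma continuous_measurable_circ:
  fixes f :: "real \<Rightarrow> 'a :: euclidean_space"
  assumes "continuous_on UNIV f"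
  shows "f \<in> borel_measurable circ"
  unfolding circ_def
  by (rule continuous_imp_measurable_on_sets_lebesgue)
     (use assms continuous_on_subset in auto)

definition circle_point :: "real \<Rightarrow> complex" where
  "circle_point x = exp (2 * pi * \<i> * of_real x)"

lemma norm_circle_point [simp]: "norm (circle_point x) = 1"
proof -
  have "circle_point x = exp (\<i> * complex_of_real (2 * pi * x))"
    by (simp add: circle_point_def mult_ac)
  thus ?thesis by (simp only: norm_exp_i_times)
qed

lemma continuous_circle_point: "continuous_on S circle_point"
  unfolding circle_point_def by (intro continuous_intros)

lemma circle_point_power: "circle_point x ^ n = exp (2 * pi * \<i> * of_nat n * of_real x)"
  by (simp add: circle_point_def mult_ac flip: exp_of_nat_mult)

lemma measurable_poly_circle [measurable]:
  "(\<lambda>x. poly p (circle_point x)) \<in> borel_measurable circ"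
  by (intro continuous_measurable_circ continuous_intros continuous_circle_point)

lemma bounded_poly_circle: "\<exists>B. \<forall>x. norm (poly p (circle_point x)) \<le> B"
proof -
  have "compact ((\<lambda>z. poly p z) ` sphere 0 1)"
    by (intro compact_continuous_image continuous_intros) auto
  then obtain B where B: "\<forall>z\<in>(\<lambda>z. poly p z) ` sphere 0 1. norm z \<le> B"
    using compact_imp_bounded bounded_iff by metis
  thus ?thesis by (auto intro!: exI[of _ B])
qed

lemma integral_circle_point_power:
  assumes "n > 0"
  shows "(\<integral>x. circle_point x ^ n \<partial>circ) = 0"
proof -
  define c where "c = 2 * pi * \<i> * of_nat n"
  have c: "c \<noteq> 0" using assms by (simp add: c_def)
  have cn: "circle_point x ^ n = exp (c * of_real x)" for x
    by (simp add: circle_point_power c_def mult_ac)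
  have int: "integrable (lebesgue_on {0..1}) (\<lambda>x. exp (c * of_real x))"
    by (intro continuous_imp_integrable_real continuous_intros)
  have "((\<lambda>x. exp (c * of_real x)) has_integral
           (exp (c * of_real 1) / c - exp (c * of_real 0) / c)) {0..1}"
  proof (rule fundamental_theorem_of_calculus)
    fix x :: real assume "x \<in> {0..1}"
    have "((\<lambda>z. exp (c * z) / c) has_field_derivative exp (c * of_real x)) (at (of_real x))"
      using c by (auto intro!: derivative_eq_intros)
    from has_vector_derivative_real_field[OF this]
    show "((\<lambda>x. exp (c * of_real x) / c) has_vector_derivative exp (c * of_real x)) (at x within {0..1})"
      by (rule has_vector_derivative_at_within)
  qed auto
  moreover have "exp (c * of_real 1) = 1"
    using exp_integer_2pi[of "of_nat n"] by (simp add: c_def mult_ac)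
  ultimately have "((\<lambda>x. exp (c * of_real x)) has_integral 0) {0..1}" by simp
  hence "integral {0..1} (\<lambda>x. exp (c * of_real x)) = 0" by (rule integral_unique)
  thus ?thesis
    using lebesgue_integral_eq_integral[OF int] by (simp add: circ_def cn)
qed

lemma integrable_circ_bounded:
  fixes f :: "real \<Rightarrow> 'a :: {banach, second_countable_topology}"
  assumes "f \<in> borel_measurable circ" "AE x in circ. norm (f x) \<le> B"
  shows "integrable circ f"
  using circ.integrable_const_bound assms by blast

lemma integrable_poly_circle: "integrable circ (\<lambda>x. poly p (circle_point x))"
proof -
  obtain B where "\<forall>x. norm (poly p (circle_point x)) \<le> B" using bounded_poly_circle by blast
  thus ?thesis by (intro integrable_circ_bounded[where B = B]) auto
qed

text \<open>Mean value property at the origin: every nonconstant monomial has mean zero.\<close>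

lemma integral_poly_circle: "(\<integral>x. poly p (circle_point x) \<partial>circ) = coeff p 0"
proof -
  have int: "integrable circ (\<lambda>x. coeff p i * circle_point x ^ i)" for i
    using integrable_poly_circle[of "monom (coeff p i) i"] by (simp add: poly_monom)
  have "(\<integral>x. poly p (circle_point x) \<partial>circ) = (\<integral>x. (\<Sum>i\<le>degree p. coeff p i * circle_point x ^ i) \<partial>circ)"
    by (simp add: poly_altdef)
  also have "\<dots> = (\<Sum>i\<le>degree p. coeff p i * (\<integral>x. circle_point x ^ i \<partial>circ))"
    by (subst Bochner_Integration.integral_sum) (auto intro: int)
  also have "\<dots> = (\<Sum>i\<le>degree p. if i = 0 then coeff p 0 else 0)"
    by (intro sum.cong) (auto simp: integral_circle_point_power)
  also have "\<dots> = coeff p 0" by simp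
  finally show ?thesis .
qed

section \<open>Fourier coefficients and closure of \<open>H1\<close> under limits\<close>

lemma fourier_kernel_measurable [measurable]:
  "(\<lambda>x. exp (- (2 * pi * \<i> * of_int k * complex_of_real x))) \<in> borel_measurable circ"
  by (intro continuous_measurable_circ continuous_intros)

lemma norm_fourier_kernel [simp]: "norm (exp (- (2 * pi * \<i> * of_int k * complex_of_real x))) = 1"
proof -
  have "- (2 * pi * \<i> * of_int k * complex_of_real x) = \<i> * complex_of_real (- (2 * pi * of_int k * x))"
    by (simp add: mult_ac)
  thus ?thesis by (simp only: norm_exp_i_times)
qed

lemma integrable_fourier:
  assumes "integrable circ f"
  shows "integrable circ (\<lambda>x. f x * exp (- (2 * pi * \<i> * of_int k * complex_of_real x)))"
  by (rule Bochner_Integration.integrable_bound[OF assms]) (use assms in \<open>auto simp: norm_mult intro!: borel_measurable_times fourier_kernel_measurable[simplified]\<close>)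

lemma fourier_coeff_add:
  assumes "integrable circ f" "integrable circ g"
  shows "fourier_coeff (\<lambda>x. f x + g x) k = fourier_coeff f k + fourier_coeff g k"
  using integrable_fourier[OF assms(1)] integrable_fourier[OF assms(2)]
  by (simp add: fourier_coeff_def distrib_right)

lemma fourier_coeff_cmult: "fourier_coeff (\<lambda>x. c * f x) k = c * fourier_coeff f k"
  by (simp add: fourier_coeff_def mult.assoc)

lemma H1_add: "f \<in> H1 \<Longrightarrow> g \<in> H1 \<Longrightarrow> (\<lambda>x. f x + g x) \<in> H1"
  by (auto simp: H1_def fourier_coeff_add)

lemma H1_cmult: "f \<in> H1 \<Longrightarrow> (\<lambda>x. c * f x) \<in> H1"
  by (auto simp: H1_def fourier_coeff_cmult)

lemma H1_diff: "f \<in> H1 \<Longrightarrow> g \<in> H1 \<Longrightarrow> (\<lambda>x. f x - g x) \<in> H1"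
  using H1_add[of f "\<lambda>x. -1 * g x"] H1_cmult[of g "-1"] by simp

lemma H1_integrable: "f \<in> H1 \<Longrightarrow> integrable circ f"
  by (simp add: H1_def)

lemma H1_measurable: "f \<in> H1 \<Longrightarrow> f \<in> borel_measurable circ"
  by (auto simp: H1_def)

lemma Hinf_subset_H1: "Hinf \<subseteq> H1"
  by (auto simp: Hinf_def H1_def intro: integrable_circ_bounded)

lemma Hinf_iff: "f \<in> Hinf \<longleftrightarrow> f \<in> H1 \<and> (\<exists>B. AE x in circ. norm (f x) \<le> B)"
  using Hinf_subset_H1 by (auto simp: Hinf_def H1_def)

text \<open>The Fourier kernel has modulus 1, so the majorant \<open>w\<close> also dominates the
  integrands that define the coefficients.\<close>

lemma H1_dominated_limit:
  assumes "\<And>i. s i \<in> H1" "f \<in> borel_measurable circ" "integrable circ w"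
    and lim: "AE x in circ. (\<lambda>i. s i x) \<longlonglongrightarrow> f x"
    and bound: "\<And>i. AE x in circ. norm (s i x) \<le> w x"
  shows "f \<in> H1"
proof -
  have m: "s i \<in> borel_measurable circ" for i using assms(1) H1_measurable by blast
  have "integrable circ f"
    by (rule integrable_dominated_convergence[OF assms(2) m assms(3) lim bound])
  moreover have "fourier_coeff f k = 0" if "k < 0" for k
  proof -
    have "(\<lambda>i. fourier_coeff (s i) k) \<longlonglongrightarrow> fourier_coeff f k"
      unfolding fourier_coeff_def
    proof (rule integral_dominated_convergence[where w = w])
      show "AE x in circ. (\<lambda>i. s i x * exp (- (2 * pi * \<i> * of_int k * complex_of_real x)))
              \<longlonglongrightarrow> f x * exp (- (2 * pi * \<i> * of_int k * complex_of_real x))"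
        using lim by eventually_elim (intro tendsto_intros)
    qed (use assms m bound in \<open>auto simp: norm_mult intro!: borel_measurable_times fourier_kernel_measurable[simplified]\<close>)
    moreover have "fourier_coeff (s i) k = 0" for i using assms(1)[of i] that by (simp add: H1_def)
    ultimately show ?thesis by (simp add: LIMSEQ_const_iff)
  qed
  ultimately show ?thesis by (simp add: H1_def)
qed

text \<open>Each coefficient is a contraction on L^1, again because the kernel has modulus
  1.\<close>

lemma H1_L1_limit:
  assumes "\<And>i. s i \<in> H1" "integrable circ f"
    and lim: "(\<lambda>i. \<integral>x. norm (s i x - f x) \<partial>circ) \<longlonglongrightarrow> 0"
  shows "f \<in> H1"
proof -
  have "fourier_coeff f k = 0" if "k < 0" for k
  proof -
    have "norm (fourier_coeff f k) \<le> (\<integral>x. norm (s i x - f x) \<partial>circ)" for i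
    proof -
      have "fourier_coeff (\<lambda>x. s i x - f x) k = fourier_coeff (s i) k - fourier_coeff f k"
        using fourier_coeff_add[of "s i" "\<lambda>x. -1 * f x" k] assms H1_integrable[of "s i"]
        by (simp add: fourier_coeff_cmult[of "-1", simplified])
      hence "norm (fourier_coeff f k) = norm (fourier_coeff (\<lambda>x. s i x - f x) k)"
        using assms(1)[of i] that by (simp add: H1_def)
      also have "\<dots> \<le> (\<integral>x. norm ((s i x - f x) * exp (- (2 * pi * \<i> * of_int k * complex_of_real x))) \<partial>circ)"
        unfolding fourier_coeff_def by (rule integral_norm_bound)
      finally show ?thesis by (simp add: norm_mult)
    qed
    hence "norm (fourier_coeff f k) \<le> 0"
      by (intro LIMSEQ_le_const[OF lim]) auto
    thus ?thesis by simp
  qed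
  thus ?thesis using assms by (simp add: H1_def)
qed

section \<open>Bounded multipliers of \<open>H1\<close>\<close>

text \<open>A working form of bounded analytic functions: as operators on \<open>H1\<close> they are
  closed under products by composition alone, with no convolution of Fourier series. The bound holds
  at every point, so that sums and products involve no exceptional sets.\<close>

definition H1_multiplier :: "(real \<Rightarrow> complex) set" where
  "H1_multiplier = {\<phi>. \<phi> \<in> borel_measurable circ \<and> (\<exists>B. \<forall>x. norm (\<phi> x) \<le> B) \<and>
     (\<forall>f\<in>H1. (\<lambda>x. \<phi> x * f x) \<in> H1)}"

lemma H1_multiplier_mult_H1: "\<phi> \<in> H1_multiplier \<Longrightarrow> f \<in> H1 \<Longrightarrow> (\<lambda>x. \<phi> x * f x) \<in> H1"
  by (auto simp: H1_multiplier_def)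

lemma H1_multiplier_measurable: "\<phi> \<in> H1_multiplier \<Longrightarrow> \<phi> \<in> borel_measurable circ"
  by (auto simp: H1_multiplier_def)

lemma H1_multiplier_const: "(\<lambda>_. c) \<in> H1_multiplier"
  by (auto simp: H1_multiplier_def H1_cmult)

lemma H1_multiplier_add:
  assumes "\<phi> \<in> H1_multiplier" "\<psi> \<in> H1_multiplier"
  shows "(\<lambda>x. \<phi> x + \<psi> x) \<in> H1_multiplier"
proof -
  obtain B B' where "\<forall>x. norm (\<phi> x) \<le> B" "\<forall>x. norm (\<psi> x) \<le> B'"
    using assms by (auto simp: H1_multiplier_def)
  hence "\<forall>x. norm (\<phi> x + \<psi> x) \<le> B + B'" by (auto intro!: norm_triangle_mono)
  thus ?thesis using assms
    by (auto simp: H1_multiplier_def distrib_right intro: H1_add)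
qed

lemma H1_multiplier_mult:
  assumes "\<phi> \<in> H1_multiplier" "\<psi> \<in> H1_multiplier"
  shows "(\<lambda>x. \<phi> x * \<psi> x) \<in> H1_multiplier"
proof -
  obtain B B' where B: "\<forall>x. norm (\<phi> x) \<le> B" "\<forall>x. norm (\<psi> x) \<le> B'"
    using assms by (auto simp: H1_multiplier_def)
  hence "\<forall>x. norm (\<phi> x * \<psi> x) \<le> B * B'"
    by (auto simp: norm_mult intro!: mult_mono intro: order_trans[OF norm_ge_zero])
  thus ?thesis using assms
    by (auto simp: H1_multiplier_def mult.assoc)
qed

lemma H1_multiplier_diff:
  assumes "\<phi> \<in> H1_multiplier" "\<psi> \<in> H1_multiplier"
  shows "(\<lambda>x. \<phi> x - \<psi> x) \<in> H1_multiplier"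
  using H1_multiplier_add[OF assms(1) H1_multiplier_mult[OF H1_multiplier_const[of "-1"] assms(2)]]
  by simp

lemma H1_multiplier_power:
  assumes "\<phi> \<in> H1_multiplier"
  shows "(\<lambda>x. \<phi> x ^ n) \<in> H1_multiplier"
  by (induction n) (auto intro: H1_multiplier_const H1_multiplier_mult assms)

lemma H1_multiplier_sum:
  assumes "\<And>i. i \<in> I \<Longrightarrow> \<phi> i \<in> H1_multiplier"
  shows "(\<lambda>x. \<Sum>i\<in>I. \<phi> i x) \<in> H1_multiplier"
  using assms
  by (induction I rule: infinite_finite_induct)
     (auto intro: H1_multiplier_const H1_multiplier_add)

text \<open>Dominated convergence with majorant \<open>B * norm (f x)\<close>, for each
  \<open>f\<close> in \<open>H1\<close> separately.\<close>

lemma H1_multiplier_limit: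
  assumes "\<And>i. s i \<in> H1_multiplier" "\<phi> \<in> borel_measurable circ"
    and "AE x in circ. (\<lambda>i. s i x) \<longlonglongrightarrow> \<phi> x"
    and "\<And>i x. norm (s i x) \<le> B" "\<And>x. norm (\<phi> x) \<le> B"
  shows "\<phi> \<in> H1_multiplier"
proof -
  have "(\<lambda>x. \<phi> x * f x) \<in> H1" if f: "f \<in> H1" for f
  proof (rule H1_dominated_limit[where s = "\<lambda>i x. s i x * f x" and w = "\<lambda>x. B * norm (f x)"])
    show "AE x in circ. (\<lambda>i. s i x * f x) \<longlonglongrightarrow> \<phi> x * f x"
      using assms(3) by eventually_elim (intro tendsto_intros)
    show "AE x in circ. norm (s i x * f x) \<le> B * norm (f x)" for i
      using assms(4) by (auto simp: norm_mult intro!: mult_right_mono)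
  qed (use f assms H1_integrable[OF f] H1_measurable[OF f] H1_multiplier_mult_H1 in auto)
  thus ?thesis using assms by (auto simp: H1_multiplier_def)
qed

text \<open>Multiplication by the coordinate moves the coefficient at \<open>k - 1\<close> to
  \<open>k\<close>, and \<open>k < 0\<close> implies \<open>k - 1 < 0\<close>.\<close>

lemma H1_multiplier_circle_point: "circle_point \<in> H1_multiplier"
proof -
  have "(\<lambda>x. circle_point x * f x) \<in> H1" if f: "f \<in> H1" for f
  proof -
    have "fourier_coeff (\<lambda>x. circle_point x * f x) k = fourier_coeff f (k - 1)" for k
      unfolding fourier_coeff_def
      by (intro Bochner_Integration.integral_cong)
         (auto simp: circle_point_def algebra_simps simp flip: exp_add)
    moreover have "integrable circ (\<lambda>x. circle_point x * f x)"
      by (rule Bochner_Integration.integrable_bound[OF H1_integrable[OF f]])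
         (use H1_measurable[OF f] measurable_poly_circle[of "[:0, 1:]"] in \<open>auto simp: norm_mult\<close>)
    ultimately show ?thesis using f by (auto simp: H1_def)
  qed
  thus ?thesis using measurable_poly_circle[of "[:0, 1:]"]
    by (auto simp: H1_multiplier_def intro: exI[of _ 1])
qed

lemma H1_multiplier_poly: "(\<lambda>x. poly p (circle_point x)) \<in> H1_multiplier"
  by (simp only: poly_altdef)
     (intro H1_multiplier_sum H1_multiplier_mult H1_multiplier_const H1_multiplier_power
       H1_multiplier_circle_point)

text \<open>Since \<open>Re (\<rho> + Y) \<ge> \<rho> > 0\<close> and \<open>Y\<close> is bounded, \<open>1 - (\<rho> + Y) / R\<close> has norm
  less than 1 for large \<open>R\<close>, so \<open>\<rho> / (\<rho> + Y)\<close> is a limit of polynomials in \<open>Y\<close>.\<close>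

lemma H1_multiplier_resolvent:
  assumes Y: "Y \<in> H1_multiplier" and Re: "\<And>x. Re (Y x) \<ge> 0" and \<rho>: "\<rho> > 0"
  shows "(\<lambda>x. of_real \<rho> / (of_real \<rho> + Y x)) \<in> H1_multiplier"
proof -
  obtain B where B: "\<And>x. norm (Y x) \<le> B" using Y by (auto simp: H1_multiplier_def)
  have B0: "B \<ge> 0" using B[of 0] norm_ge_zero order_trans by blast
  \<comment> \<open>For u = \<open>of_real \<rho> + Y x\<close> this choice gives |u|^2 \<le> R
    \<rho>, so the square of |1 - u / R| is at most 1 - 2 \<rho> / R + \<rho> / R = 1 - \<rho> /
    R.\<close>
  define R where "R = (\<rho> + B)\<^sup>2 / \<rho>"
  have R: "R > 0" using \<rho> B0 by (simp add: R_def)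
  define q where "q x = 1 - (of_real \<rho> + Y x) / of_real R" for x
  define \<theta> where "\<theta> = sqrt (1 - \<rho> / R)"
  have bnd: "norm (q x) \<le> \<theta>" for x
  proof -
    let ?u = "of_real \<rho> + Y x"
    have "norm ?u \<le> \<rho> + B"
      using norm_triangle_ineq[of "of_real \<rho>" "Y x"] B[of x] \<rho> by simp
    hence "(norm ?u)\<^sup>2 \<le> (\<rho> + B)\<^sup>2" by (intro power_mono) auto
    hence n: "(norm ?u)\<^sup>2 \<le> R * \<rho>" using \<rho> by (simp add: R_def)
    have "(norm (q x))\<^sup>2 = (1 - Re ?u / R)\<^sup>2 + (Im ?u / R)\<^sup>2"
      unfolding cmod_power2 q_def by simp
    also have "\<dots> = 1 - 2 * Re ?u / R + (norm ?u)\<^sup>2 / R\<^sup>2"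
      unfolding cmod_power2 by (simp add: power2_eq_square field_simps add_divide_distrib)
    also have "\<dots> \<le> 1 - 2 * \<rho> / R + R * \<rho> / R\<^sup>2"
      using n Re[of x] R by (intro add_mono diff_mono divide_right_mono) auto
    also have "\<dots> = 1 - \<rho> / R" using R by (simp add: power2_eq_square field_simps)
    finally show ?thesis unfolding \<theta>_def by (rule real_le_rsqrt)
  qed
  have \<theta>: "\<theta> < 1" "0 \<le> \<theta>"
    using \<rho> R order_trans[OF norm_ge_zero bnd[of 0]] by (auto simp: \<theta>_def)
  have ne: "of_real \<rho> + Y x \<noteq> 0" for x
  proof
    assume "of_real \<rho> + Y x = 0"
    hence "Re (of_real \<rho> + Y x) = 0" by simp
    thus False using Re[of x] \<rho> by simp
  qed
  \<comment> \<open>Partial sums of a Neumann series: \<open>q x\<close> is 1 - u / R, so \<rho> / u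
    = (\<rho> / R) / (1 - q).\<close>
  define s where "s k x = of_real (\<rho> / R) * (\<Sum>i<k. q x ^ i)" for k x
  have qm: "q \<in> H1_multiplier"
    using H1_multiplier_diff[OF H1_multiplier_const[of 1]
      H1_multiplier_mult[OF H1_multiplier_const[of "1 / of_real R"]
      H1_multiplier_add[OF H1_multiplier_const[of "of_real \<rho>"] Y]]]
    unfolding q_def by simp
  have norm_lim: "norm (of_real \<rho> / (of_real \<rho> + Y x)) \<le> 1" for x
  proof -
    have "\<rho> \<le> Re (of_real \<rho> + Y x)" using Re[of x] by simp
    also have "\<dots> \<le> norm (of_real \<rho> + Y x)" by (rule complex_Re_le_cmod)
    finally show ?thesis using \<rho> by (simp add: norm_divide divide_simps)
  qed
  have ns: "norm (s k x) \<le> max 1 (\<rho> / R / (1 - \<theta>))" for k x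
  proof -
    have "norm (\<Sum>i<k. q x ^ i) \<le> (\<Sum>i<k. \<theta> ^ i)"
      by (intro sum_norm_le) (auto simp: norm_power intro!: power_mono bnd)
    also have "\<dots> \<le> (\<Sum>i. \<theta> ^ i)"
      using \<theta> by (intro sum_le_suminf) auto
    also have "\<dots> = 1 / (1 - \<theta>)" using \<theta> by (simp add: suminf_geometric)
    finally have "\<rho> / R * norm (\<Sum>i<k. q x ^ i) \<le> \<rho> / R * (1 / (1 - \<theta>))"
      using \<rho> R by (intro mult_left_mono) auto
    thus ?thesis using \<rho> R by (simp add: s_def norm_mult norm_divide)
  qed
  have lim: "(\<lambda>k. s k x) \<longlonglongrightarrow> of_real \<rho> / (of_real \<rho> + Y x)" for x
  proof -
    have "norm (q x) < 1" using bnd[of x] \<theta> by simp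
    hence "(\<lambda>k. \<Sum>i<k. q x ^ i) \<longlonglongrightarrow> 1 / (1 - q x)"
      using geometric_sums sums_def by blast
    hence "(\<lambda>k. s k x) \<longlonglongrightarrow> of_real (\<rho> / R) * (1 / (1 - q x))"
      unfolding s_def by (intro tendsto_intros)
    also have "of_real (\<rho> / R) * (1 / (1 - q x)) = of_real \<rho> / (of_real \<rho> + Y x)"
      using R ne[of x] by (simp add: q_def field_simps)
    finally show ?thesis .
  qed
  show ?thesis
  proof (rule H1_multiplier_limit[where s = s and B = "max 1 (\<rho> / R / (1 - \<theta>))"])
    show "s i \<in> H1_multiplier" for i
      unfolding s_def
      by (intro H1_multiplier_mult H1_multiplier_const H1_multiplier_sum H1_multiplier_power qm)
    show "(\<lambda>x. of_real \<rho> / (of_real \<rho> + Y x)) \<in> borel_measurable circ"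
      using H1_multiplier_measurable[OF Y] by measurable
    show "norm (of_real \<rho> / (of_real \<rho> + Y x)) \<le> max 1 (\<rho> / R / (1 - \<theta>))" for x
      using norm_lim[of x] by simp
  qed (use lim ns in auto)
qed

subsection \<open>Integration and trigonometric approximation\<close>

text \<open>The bounds \<open>c j\<close> may vary with \<open>j\<close>, since the L^2 estimate in
  \<open>exists_analytic_with_real_part\<close> carries an error that vanishes only in the
  limit.\<close>

lemma Fatou_integral:
  fixes g :: "nat \<Rightarrow> 'a \<Rightarrow> real"
  assumes int: "\<And>j. integrable M (g j)" and nn: "\<And>j x. g j x \<ge> 0"
    and G: "G \<in> borel_measurable M" "AE x in M. (\<lambda>j. g j x) \<longlonglongrightarrow> G x"
    and le: "\<And>j. (\<integral>x. g j x \<partial>M) \<le> c j" and c: "c \<longlonglongrightarrow> C"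
  shows "integrable M G" "(\<integral>x. G x \<partial>M) \<le> C"
proof -
  have c0: "0 \<le> c j" for j
    using le[of j] nn by (meson Bochner_Integration.integral_nonneg order_trans)
  have C0: "0 \<le> C" by (rule LIMSEQ_le_const[OF c]) (use c0 in auto)
  have G0: "AE x in M. 0 \<le> G x"
    using G(2) by eventually_elim (rule LIMSEQ_le_const, auto simp: nn)
  have "(\<integral>\<^sup>+x. ennreal (G x) \<partial>M) = (\<integral>\<^sup>+x. liminf (\<lambda>j. ennreal (g j x)) \<partial>M)"
  proof (rule nn_integral_cong_AE)
    show "AE x in M. ennreal (G x) = liminf (\<lambda>j. ennreal (g j x))"
      using G(2)
    proof eventually_elim
      case (elim x)
      hence "(\<lambda>j. ennreal (g j x)) \<longlonglongrightarrow> ennreal (G x)" by (intro tendsto_ennrealI)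
      thus ?case by (simp add: lim_imp_Liminf)
    qed
  qed
  also have "\<dots> \<le> liminf (\<lambda>j. \<integral>\<^sup>+x. ennreal (g j x) \<partial>M)"
    by (intro nn_integral_liminf) (use int in auto)
  also have "\<dots> \<le> liminf (\<lambda>j. ennreal (c j))"
  proof (intro Liminf_mono always_eventually allI)
    fix j
    have "(\<integral>\<^sup>+x. ennreal (g j x) \<partial>M) = ennreal (\<integral>x. g j x \<partial>M)"
      by (intro nn_integral_eq_integral int) (simp add: nn)
    thus "(\<integral>\<^sup>+x. ennreal (g j x) \<partial>M) \<le> ennreal (c j)" using le[of j] by (simp add: ennreal_leI)
  qed
  also have "\<dots> = ennreal C"
    by (intro lim_imp_Liminf tendsto_ennrealI c) simp
  finally have *: "(\<integral>\<^sup>+x. ennreal (G x) \<partial>M) \<le> ennreal C" .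
  show "integrable M G"
  proof (rule integrableI_bounded)
    have "(\<integral>\<^sup>+x. ennreal (norm (G x)) \<partial>M) = (\<integral>\<^sup>+x. ennreal (G x) \<partial>M)"
      by (intro nn_integral_cong_AE) (use G0 in eventually_elim, simp)
    thus "(\<integral>\<^sup>+x. ennreal (norm (G x)) \<partial>M) < \<infinity>"
      using * by (metis ennreal_less_top infinity_ennreal_def order_le_less_trans)
  qed (use G in auto)
  then show "(\<integral>x. G x \<partial>M) \<le> C"
    using nn_integral_eq_integral[of M G] G0 * C0 by simp
qed

text \<open>Completeness of L^1. A subsequence converges almost everywhere; Fatou, with the index
  \<open>i\<close> fixed, turns the Cauchy estimates into estimates against its limit.\<close>

lemma L1_Cauchy_limit:
  fixes s :: "nat \<Rightarrow> 'a \<Rightarrow> 'b :: {banach, second_countable_topology}"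
  assumes int: "\<And>n. integrable M (s n)"
    and cau: "\<And>e. e > 0 \<Longrightarrow> \<exists>N. \<forall>i\<ge>N. \<forall>j\<ge>N. (\<integral>x. norm (s i x - s j x) \<partial>M) < e"
  obtains f where "integrable M f" "(\<lambda>n. \<integral>x. norm (s n x - f x) \<partial>M) \<longlonglongrightarrow> 0"
proof -
  obtain r where r: "strict_mono r" "AE x in M. Cauchy (\<lambda>i. s (r i) x)"
    using cauchy_L1_AE_cauchy_subseq[OF int cau] by blast
  define f where "f x = lim (\<lambda>i. s (r i) x)" for x
  have [measurable]: "s n \<in> borel_measurable M" for n using int by auto
  have [measurable]: "f \<in> borel_measurable M" unfolding f_def by measurable
  have lim: "AE x in M. (\<lambda>i. s (r i) x) \<longlonglongrightarrow> f x"
    using r(2) by eventually_elim (simp add: f_def Cauchy_convergent_iff convergent_LIMSEQ_iff)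
  have key: "integrable M (\<lambda>x. norm (s i x - f x)) \<and> (\<integral>x. norm (s i x - f x) \<partial>M) \<le> e"
    if N: "\<forall>i\<ge>N. \<forall>j\<ge>N. (\<integral>x. norm (s i x - s j x) \<partial>M) < e" and i: "i \<ge> N" for e N i
  proof -
    \<comment> \<open>The shift by \<open>N\<close> puts every index \<open>r (j + N)\<close> into
      the range of the Cauchy bound.\<close>
    let ?g = "\<lambda>j x. norm (s i x - s (r (j + N)) x)"
    have a: "integrable M (?g j)" for j using int by auto
    have b: "AE x in M. (\<lambda>j. ?g j x) \<longlonglongrightarrow> norm (s i x - f x)"
      using lim
    proof eventually_elim
      case (elim x)
      from LIMSEQ_ignore_initial_segment[OF elim, of N]
      show ?case by (intro tendsto_intros)
    qed
    have c: "(\<integral>x. ?g j x \<partial>M) \<le> e" for j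
      using N i seq_suble[OF r(1), of "j + N"] by (meson le_add2 less_imp_le order_trans)
    show ?thesis
      using Fatou_integral[OF a _ _ b c tendsto_const] by auto
  qed
  obtain N where N: "\<forall>i\<ge>N. \<forall>j\<ge>N. (\<integral>x. norm (s i x - s j x) \<partial>M) < 1" using cau[of 1] by auto
  have "integrable M (\<lambda>x. s N x - f x)"
    using key[OF N order_refl, THEN conjunct1] by (subst (asm) integrable_norm_iff) auto
  from Bochner_Integration.integrable_diff[OF int[of N] this] have f: "integrable M f" by simp
  moreover have "(\<lambda>n. \<integral>x. norm (s n x - f x) \<partial>M) \<longlonglongrightarrow> 0"
  proof (rule LIMSEQ_I)
    fix e :: real assume e: "e > 0"
    obtain N where N: "\<forall>i\<ge>N. \<forall>j\<ge>N. (\<integral>x. norm (s i x - s j x) \<partial>M) < e / 2"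
      using cau[of "e / 2"] e by auto
    have "norm ((\<integral>x. norm (s n x - f x) \<partial>M) - 0) < e" if "n \<ge> N" for n
      using key[OF N that] e by (simp add: abs_of_nonneg Bochner_Integration.integral_nonneg)
    thus "\<exists>no. \<forall>n\<ge>no. norm ((\<integral>x. norm (s n x - f x) \<partial>M) - 0) < e" by blast
  qed
  ultimately show ?thesis using that by blast
qed

text \<open>The total mass is 1, so the inequality says that the variance of |f| is
  nonnegative.\<close>

lemma circ_L2_imp_L1:
  fixes f :: "real \<Rightarrow> 'a :: {banach, second_countable_topology}"
  assumes [measurable]: "f \<in> borel_measurable circ" and f2: "integrable circ (\<lambda>x. (norm (f x))\<^sup>2)"
  shows "integrable circ f" "(\<integral>x. norm (f x) \<partial>circ)\<^sup>2 \<le> (\<integral>x. (norm (f x))\<^sup>2 \<partial>circ)"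
proof -
  have "integrable circ (\<lambda>x. 1 + (norm (f x))\<^sup>2)" using f2 by auto
  moreover have "norm (f x) \<le> norm (1 + (norm (f x))\<^sup>2)" for x
    using sum_power2_ge_zero[of "norm (f x) - 1" 0] zero_le_power2[of "norm (f x)"]
    by (simp add: power2_eq_square algebra_simps)
       (smt (verit) mult_nonneg_nonneg norm_ge_zero)
  ultimately show int: "integrable circ f"
    by (intro Bochner_Integration.integrable_bound[where g = f]) auto
  define c where "c = (\<integral>x. norm (f x) \<partial>circ)"
  have "0 \<le> (\<integral>x. (norm (f x) - c)\<^sup>2 \<partial>circ)" by simp
  also have "\<dots> = (\<integral>x. (norm (f x))\<^sup>2 - 2 * c * norm (f x) + c\<^sup>2 \<partial>circ)"
    by (simp add: power2_diff algebra_simps)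
  also have "\<dots> = (\<integral>x. (norm (f x))\<^sup>2 \<partial>circ) - 2 * c * c + c\<^sup>2"
    using int f2 by (simp add: c_def)
  finally show "c\<^sup>2 \<le> (\<integral>x. (norm (f x))\<^sup>2 \<partial>circ)" by (simp add: power2_eq_square)
qed

lemma norm_half_parallelogram:
  fixes a b :: complex
  shows "(norm ((a + b) / 2))\<^sup>2 + (norm ((a - b) / 2))\<^sup>2 = ((norm a)\<^sup>2 + (norm b)\<^sup>2) / 2"
  unfolding cmod_power2 by (simp add: power2_eq_square field_simps)

lemma integral_half_parallelogram:
  assumes [measurable]: "a \<in> borel_measurable circ" "b \<in> borel_measurable circ"
    and i: "integrable circ (\<lambda>x. (norm (a x))\<^sup>2)" "integrable circ (\<lambda>x. (norm (b x))\<^sup>2)"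
  shows "integrable circ (\<lambda>x. (norm ((a x + b x) / 2 :: complex))\<^sup>2)"
    "integrable circ (\<lambda>x. (norm ((a x - b x) / 2))\<^sup>2)"
    "(\<integral>x. (norm ((a x + b x) / 2))\<^sup>2 \<partial>circ) + (\<integral>x. (norm ((a x - b x) / 2))\<^sup>2 \<partial>circ)
      = ((\<integral>x. (norm (a x))\<^sup>2 \<partial>circ) + (\<integral>x. (norm (b x))\<^sup>2 \<partial>circ)) / 2"
proof -
  have s: "integrable circ (\<lambda>x. ((norm (a x))\<^sup>2 + (norm (b x))\<^sup>2) / 2)" using i by auto
  have le: "(norm ((a x + b x) / 2))\<^sup>2 \<le> ((norm (a x))\<^sup>2 + (norm (b x))\<^sup>2) / 2"
    "(norm ((a x - b x) / 2))\<^sup>2 \<le> ((norm (a x))\<^sup>2 + (norm (b x))\<^sup>2) / 2" for x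
    using norm_half_parallelogram[of "a x" "b x"] zero_le_power2[of "norm ((a x + b x) / 2)"]
      zero_le_power2[of "norm ((a x - b x) / 2)"] by linarith+
  show 1: "integrable circ (\<lambda>x. (norm ((a x + b x) / 2))\<^sup>2)"
    by (rule Bochner_Integration.integrable_bound[OF s]) (measurable, intro always_eventually allI,
       use le in \<open>simp add: abs_of_nonneg del: norm_divide_numeral\<close>)
  show 2: "integrable circ (\<lambda>x. (norm ((a x - b x) / 2))\<^sup>2)"
    by (rule Bochner_Integration.integrable_bound[OF s]) (measurable, intro always_eventually allI,
       use le in \<open>simp add: abs_of_nonneg del: norm_divide_numeral\<close>)
  have "(\<integral>x. (norm ((a x + b x) / 2))\<^sup>2 \<partial>circ) + (\<integral>x. (norm ((a x - b x) / 2))\<^sup>2 \<partial>circ)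
     = (\<integral>x. (norm ((a x + b x) / 2))\<^sup>2 + (norm ((a x - b x) / 2))\<^sup>2 \<partial>circ)"
    by (rule Bochner_Integration.integral_add[symmetric, OF 1 2])
  also have "\<dots> = (\<integral>x. ((norm (a x))\<^sup>2 + (norm (b x))\<^sup>2) / 2 \<partial>circ)"
    by (simp only: norm_half_parallelogram)
  also have "\<dots> = ((\<integral>x. (norm (a x))\<^sup>2 \<partial>circ) + (\<integral>x. (norm (b x))\<^sup>2 \<partial>circ)) / 2" using i by simp
  finally show "(\<integral>x. (norm ((a x + b x) / 2))\<^sup>2 \<partial>circ) + (\<integral>x. (norm ((a x - b x) / 2))\<^sup>2 \<partial>circ)
      = ((\<integral>x. (norm (a x))\<^sup>2 \<partial>circ) + (\<integral>x. (norm (b x))\<^sup>2 \<partial>circ)) / 2" .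
qed

lemma geometric_half_summable_bounded:
  fixes c :: "nat \<Rightarrow> real"
  assumes "\<And>n. 0 \<le> c n" "\<And>n. c n \<le> B"
  shows "summable (\<lambda>n. (1 / 2) ^ n * c n)" "(\<Sum>n. (1 / 2) ^ n * c n) \<le> 2 * B"
proof -
  have s: "summable (\<lambda>n. (1 / 2 :: real) ^ n * B)" by (intro summable_mult2 summable_geometric) simp
  have le: "(1 / 2) ^ n * c n \<le> (1 / 2) ^ n * B" for n using assms by (intro mult_left_mono) auto
  show 1: "summable (\<lambda>n. (1 / 2) ^ n * c n)"
    by (rule summable_comparison_test'[OF s, of 0]) (use assms le in auto)
  have "(\<Sum>n. (1 / 2) ^ n * c n) \<le> (\<Sum>n. (1 / 2 :: real) ^ n * B)" by (intro suminf_le le 1 s)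
  also have "\<dots> = (\<Sum>n. (1 / 2 :: real) ^ n) * B"
    by (rule suminf_mult2[symmetric]) (intro summable_geometric, simp)
  also have "\<dots> = 2 * B" by (subst suminf_geometric) auto
  finally show "(\<Sum>n. (1 / 2) ^ n * c n) \<le> 2 * B" .
qed

section \<open>Real parts of polynomials on the circle\<close>

text \<open>Re u Re v is half of Re (u v) + Re (u cnj v), and on the circle \<open>cnj z\<close> is
  the inverse of \<open>z\<close>. Thus u cnj v is a monomial in \<open>z\<close> or the conjugate
  of one; conjugation keeps the real part, so the exponent can be made nonnegative.\<close>

lemma circle_monom_product:
  assumes "norm (z :: complex) = 1"
  shows "Re (a * z ^ i) * Re (b * z ^ j) =
    Re (poly (monom (a * b / 2) (i + j) +
      (if j \<le> i then monom (a * cnj b / 2) (i - j) else monom (cnj a * b / 2) (j - i))) z)"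
proof -
  have zz: "z * cnj z = 1" using assms complex_norm_square[of z] by simp
  have zk: "z ^ k * cnj z ^ k = 1" for k by (metis zz power_mult_distrib power_one)
  have ReRe: "Re u * Re v = Re (u * v / 2) + Re (u * cnj v / 2)" for u v
    by (simp add: field_simps)
  have "Re (a * z ^ i * cnj (b * z ^ j) / 2) =
     Re (poly (if j \<le> i then monom (a * cnj b / 2) (i - j) else monom (cnj a * b / 2) (j - i)) z)"
  proof (cases "j \<le> i")
    case True
    then obtain k where k: "i = j + k" using le_Suc_ex by blast
    have "a * z ^ i * cnj (b * z ^ j) / 2 = a * cnj b / 2 * z ^ k * (z ^ j * cnj z ^ j)"
      by (simp add: k power_add)
    thus ?thesis using True by (simp only: zk) (simp add: k poly_monom)
  next
    case False
    then obtain k where k: "j = i + k" using le_Suc_ex[of i j] by auto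
    have "a * z ^ i * cnj (b * z ^ j) / 2 = cnj (cnj a * b / 2 * z ^ k) * (z ^ i * cnj z ^ i)"
      by (simp add: k power_add)
    hence "Re (a * z ^ i * cnj (b * z ^ j) / 2) = Re (cnj a * b / 2 * z ^ k)"
      by (simp only: zk mult_1_right complex_cnj(1) cnj.sel)
    thus ?thesis using False by (simp add: k poly_monom)
  qed
  thus ?thesis unfolding ReRe[of "a * z ^ i"] by (simp add: poly_monom power_add mult_ac)
qed

lemma circle_Re_poly_product:
  "\<exists>r. \<forall>z. norm (z :: complex) = 1 \<longrightarrow> Re (poly p z) * Re (poly q z) = Re (poly r z)"
proof -
  define R where "R i j = monom (coeff p i * coeff q j / 2) (i + j) +
      (if j \<le> i then monom (coeff p i * cnj (coeff q j) / 2) (i - j)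
       else monom (cnj (coeff p i) * coeff q j / 2) (j - i))" for i j
  have "Re (poly p z) * Re (poly q z) = Re (poly (\<Sum>i\<le>degree p. \<Sum>j\<le>degree q. R i j) z)"
    if "norm z = 1" for z
  proof -
    have "Re (poly p z) * Re (poly q z) =
       (\<Sum>i\<le>degree p. \<Sum>j\<le>degree q. Re (coeff p i * z ^ i) * Re (coeff q j * z ^ j))"
      by (simp only: poly_altdef Re_sum sum_product)
    also have "\<dots> = (\<Sum>i\<le>degree p. \<Sum>j\<le>degree q. Re (poly (R i j) z))"
      unfolding R_def by (simp only: circle_monom_product[OF that])
    finally show ?thesis by (simp only: poly_sum Re_sum)
  qed
  thus ?thesis by blast
qed

text \<open>The algebra for Stone-Weierstrass: trigonometric polynomials written as real parts, so
  that each approximant comes with its analytic completion. Points are separated by Re z and by Im z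
  = Re (-i z).\<close>

lemma function_ring_circle_Re_poly:
  "function_ring_on {g. \<exists>p. \<forall>z\<in>sphere 0 1. g z = Re (poly p z)} (sphere (0::complex) 1)"
proof
  fix f g assume "f \<in> {g. \<exists>p. \<forall>z\<in>sphere 0 1. g z = Re (poly p z)}"
    and "g \<in> {g. \<exists>p. \<forall>z\<in>sphere 0 1. g z = Re (poly p z)}"
  then obtain p q where p: "\<forall>z\<in>sphere 0 1. f z = Re (poly p z)"
    and q: "\<forall>z\<in>sphere 0 1. g z = Re (poly q z)" by auto
  show "(\<lambda>x. f x + g x) \<in> {g. \<exists>p. \<forall>z\<in>sphere 0 1. g z = Re (poly p z)}"
    using p q by (auto intro!: exI[of _ "p + q"])
  obtain r where "\<forall>z. norm z = 1 \<longrightarrow> Re (poly p z) * Re (poly q z) = Re (poly r z)"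
    using circle_Re_poly_product by blast
  thus "(\<lambda>x. f x * g x) \<in> {g. \<exists>p. \<forall>z\<in>sphere 0 1. g z = Re (poly p z)}"
    using p q by (auto intro!: exI[of _ r])
next
  fix f assume "f \<in> {g. \<exists>p. \<forall>z\<in>sphere 0 1. g z = Re (poly p z)}"
  then obtain p where p: "\<forall>z\<in>sphere 0 1. f z = Re (poly p z)" by auto
  have "continuous_on (sphere 0 1) (\<lambda>z. Re (poly p z))" by (intro continuous_intros)
  thus "continuous_on (sphere 0 1) f" by (rule continuous_on_eq) (use p in auto)
next
  fix c :: real
  show "(\<lambda>_. c) \<in> {g. \<exists>p. \<forall>z\<in>sphere 0 1. g z = Re (poly p z)}"
    by (auto intro!: exI[of _ "[:complex_of_real c:]"])
next
  fix x y :: complex assume "x \<noteq> y"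
  then consider "Re x \<noteq> Re y" | "Im x \<noteq> Im y" using complex_eqI by blast
  thus "\<exists>f\<in>{g. \<exists>p. \<forall>z\<in>sphere 0 1. g z = Re (poly p z)}. f x \<noteq> f y"
  proof cases
    case 1
    thus ?thesis by (intro bexI[of _ Re]) (auto intro!: exI[of _ "[:0, 1:]"])
  next
    case 2
    thus ?thesis by (intro bexI[of _ Im]) (auto intro!: exI[of _ "[:0, -\<i>:]"])
  qed
qed auto

lemma circle_nonneg_poly_approx:
  assumes cont: "continuous_on {0..1} c" and per: "c 0 = c 1"
    and nn: "\<And>x. x \<in> {0..1} \<Longrightarrow> c x \<ge> 0" and e: "e > 0"
  shows "\<exists>p. Im (coeff p 0) = 0 \<and> (\<forall>x. Re (poly p (circle_point x)) \<ge> 0) \<and>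
    (\<forall>x\<in>{0..1}. \<bar>c x - Re (poly p (circle_point x))\<bar> < e)"
proof -
  \<comment> \<open>\<open>c\<close> transported to the circle. Because \<open>c 0 = c 1\<close>
    there is no jump at the branch point of \<open>Arg2pi\<close>; the constant homotopy from
    \<open>c\<close> to itself delivers this continuity.\<close>
  define G where "G = c \<circ> (\<lambda>z. Arg2pi z / (2 * pi))"
  have "homotopic_loops UNIV c c"
    using cont per by (simp add: homotopic_loops_refl path_def pathstart_def pathfinish_def)
  hence "homotopic_with_canon (\<lambda>h. True) (sphere 0 1) UNIV G G"
    unfolding G_def by (rule homotopic_loops_imp_homotopic_circlemaps)
  hence contG: "continuous_on (sphere 0 1) G"
    using homotopic_with_imp_continuous by blast
  interpret function_ring_on "{g. \<exists>p. \<forall>z\<in>sphere 0 1. g z = Re (poly p z)}" "sphere (0::complex) 1"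
    by (rule function_ring_circle_Re_poly)
  obtain p where p: "\<forall>z\<in>sphere 0 1. \<bar>G z - Re (poly p z)\<bar> < e / 2"
    using Stone_Weierstrass_basic[OF contG, of "e / 2"] e by fastforce
  \<comment> \<open>Adding e / 2 absorbs the error and makes the real part nonnegative; the
    imaginary constant does not affect the real part and makes \<open>coeff q 0\<close>
    real.\<close>
  define q where "q = p + [:of_real (e / 2) - \<i> * of_real (Im (coeff p 0)):]"
  have q: "Re (poly q z) = Re (poly p z) + e / 2" for z by (simp add: q_def)
  have G0: "G z \<ge> 0" for z
    using Arg2pi_ge_0[of z] Arg2pi_lt_2pi[of z] unfolding G_def by (auto intro!: nn)
  have Gc: "G (circle_point x) = c x" if "x \<in> {0..1}" for x
  proof (cases "x = 1")
    case True
    have "circle_point 1 = 1" using exp_two_pi_i by (simp add: circle_point_def)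
    thus ?thesis using True per by (simp add: G_def Arg2pi_of_real[of 1, simplified])
  next
    case False
    have "Arg2pi (circle_point x) = 2 * pi * x"
      unfolding circle_point_def using that False by (subst Arg2pi_exp) auto
    thus ?thesis by (simp add: G_def)
  qed
  have pb: "\<bar>G (circle_point x) - Re (poly p (circle_point x))\<bar> < e / 2" for x using p by auto
  show ?thesis
  proof (intro exI[of _ q] conjI allI ballI)
    show "Im (coeff q 0) = 0" by (simp add: q_def)
    show "0 \<le> Re (poly q (circle_point x))" for x
      using pb[of x] G0[of "circle_point x"] unfolding q by linarith
    show "\<bar>c x - Re (poly q (circle_point x))\<bar> < e" if "x \<in> {0..1}" for x
      using pb[of x] e unfolding q Gc[OF that] by linarith
  qed
qed

lemma AE_circ_negligible:
  assumes "negligible N"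
  shows "AE x in circ. x \<notin> N"
proof -
  have "AE x in lebesgue. x \<notin> N"
    using assms by (intro AE_not_in) (simp add: negligible_iff_null_sets)
  thus ?thesis unfolding circ_def by (subst AE_restrict_space_iff) auto
qed

text \<open>Polynomial approximation takes place on the circle and so requires loops; forcing the
  value 0 at both endpoints does not disturb convergence almost everywhere.\<close>

lemma continuous_loop_approx_bounded:
  fixes w :: "real \<Rightarrow> real"
  assumes [measurable]: "w \<in> borel_measurable circ" and M: "0 \<le> M" and w: "\<And>x. 0 \<le> w x" "\<And>x. w x \<le> M"
  shows "\<exists>c. (\<forall>k::nat. continuous_on UNIV (c k) \<and> c k 0 = 0 \<and> c k 1 = 0 \<and>
      (\<forall>x\<in>{0..1}. 0 \<le> c k x \<and> c k x \<le> M)) \<and>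
    (AE x in circ. (\<lambda>k. c k x) \<longlonglongrightarrow> w x)"
proof -
  have "w measurable_on {0..1}"
    using assms(1) by (subst measurable_on_iff_borel_measurable) (auto simp: circ_def)
  then obtain N g where N: "negligible N" and g: "\<And>n. continuous_on UNIV (g n)"
    and lim: "\<And>x. x \<notin> N \<Longrightarrow> (\<lambda>n. g n x) \<longlonglongrightarrow> (if x \<in> {0..1} then w x else 0)"
    unfolding measurable_on_def by blast
  \<comment> \<open>Clamping to [0, M] keeps the bounds. The second factor vanishes at 0 and 1, and
    equals 1 at each interior point once \<open>k\<close> is large.\<close>
  define c where "c k x = max 0 (min M (g k x)) * min 1 (real k * (x * (1 - x)))" for k x
  have "AE x in circ. x \<notin> N \<union> {0, 1}"
    by (intro AE_circ_negligible negligible_Un N) auto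
  moreover have "AE x in circ. x \<in> {0..1}" using AE_space[of circ] by simp
  ultimately have "AE x in circ. (\<lambda>k. c k x) \<longlonglongrightarrow> w x"
  proof eventually_elim
    case (elim x)
    hence x: "0 < x" "x < 1" "x \<notin> N" by auto
    have "(\<lambda>k. max 0 (min M (g k x))) \<longlonglongrightarrow> max 0 (min M (w x))"
      using lim[of x] x by (intro tendsto_intros) auto
    moreover have "(\<lambda>k. min 1 (real k * (x * (1 - x)))) \<longlonglongrightarrow> 1"
    proof (rule tendsto_eventually)
      have "eventually (\<lambda>k. real k > 1 / (x * (1 - x))) sequentially"
        using filterlim_real_sequentially by (simp add: filterlim_at_top_dense)
      thus "eventually (\<lambda>k. min 1 (real k * (x * (1 - x))) = 1) sequentially"
      proof eventually_elim
        case (elim k)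
        have "x * (1 - x) > 0" using x by simp
        thus ?case using elim by (simp add: divide_simps mult_ac)
      qed
    qed
    ultimately have "(\<lambda>k. c k x) \<longlonglongrightarrow> max 0 (min M (w x)) * 1"
      unfolding c_def by (intro tendsto_mult)
    thus ?case using w[of x] by simp
  qed
  moreover have "continuous_on UNIV (c k) \<and> c k 0 = 0 \<and> c k 1 = 0 \<and>
      (\<forall>x\<in>{0..1}. 0 \<le> c k x \<and> c k x \<le> M)" for k
  proof (intro conjI ballI)
    show "continuous_on UNIV (c k)" unfolding c_def by (intro continuous_intros g)
    fix x :: real assume "x \<in> {0..1}"
    thus "0 \<le> c k x" by (simp add: c_def)
    have "c k x \<le> M * 1" unfolding c_def
      using M \<open>x \<in> {0..1}\<close> by (intro mult_mono) auto
    thus "c k x \<le> M" by simp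
  qed (auto simp: c_def)
  ultimately show ?thesis by blast
qed

text \<open>Three errors add up: truncation at level \<open>M\<close>, continuous loops,
  polynomials. Each mean square is at most e / 12, and they enter with factors 4, 4 and 2, for a
  total of at most 10 e / 12.\<close>

lemma L2_nonneg_poly_approx:
  assumes [measurable]: "w \<in> borel_measurable circ" and w: "\<And>x. 0 \<le> w x"
    and w2: "integrable circ (\<lambda>x. (w x)\<^sup>2)" and e: "e > 0"
  shows "\<exists>p. Im (coeff p 0) = 0 \<and> (\<forall>x. Re (poly p (circle_point x)) \<ge> 0) \<and>
     (\<integral>x. (w x - Re (poly p (circle_point x)))\<^sup>2 \<partial>circ) < e"
proof -
  have "(\<lambda>k. \<integral>x. (w x - min (w x) (real k))\<^sup>2 \<partial>circ) \<longlonglongrightarrow> (\<integral>x. 0 \<partial>circ)"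
  proof (rule integral_dominated_convergence[where w = "\<lambda>x. (w x)\<^sup>2"])
    show "AE x in circ. (\<lambda>k. (w x - min (w x) (real k))\<^sup>2) \<longlonglongrightarrow> 0"
    proof (rule AE_I2, rule tendsto_eventually)
      fix x
      have "eventually (\<lambda>k. real k > w x) sequentially"
        using filterlim_real_sequentially by (simp add: filterlim_at_top_dense)
      thus "eventually (\<lambda>k. (w x - min (w x) (real k))\<^sup>2 = 0) sequentially"
        by eventually_elim simp
    qed
    show "AE x in circ. norm ((w x - min (w x) (real k))\<^sup>2) \<le> (w x)\<^sup>2" for k
      using w by (auto intro!: power_mono always_eventually)
  qed (use w2 in auto)
  hence "eventually (\<lambda>k. (\<integral>x. (w x - min (w x) (real k))\<^sup>2 \<partial>circ) < e / 12) sequentially"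
    using e by (intro order_tendstoD) auto
  then obtain k where k: "(\<integral>x. (w x - min (w x) (real k))\<^sup>2 \<partial>circ) < e / 12"
    by (auto dest: eventually_happens)
  define M where "M = real k"
  define v where "v x = min (w x) M" for x
  have [measurable]: "v \<in> borel_measurable circ" unfolding v_def by measurable
  have v: "0 \<le> v x" "v x \<le> M" "v x \<le> w x" for x using w[of x] by (auto simp: v_def M_def)
  have vw: "(\<integral>x. (w x - v x)\<^sup>2 \<partial>circ) < e / 12" using k by (simp add: v_def M_def)
  have M0: "0 \<le> M" by (simp add: M_def)
  obtain c where c': "\<forall>k::nat. continuous_on UNIV (c k) \<and> c k 0 = 0 \<and> c k 1 = 0 \<and>
      (\<forall>x\<in>{0..1}. 0 \<le> c k x \<and> c k x \<le> M)"
    and clim: "AE x in circ. (\<lambda>k. c k x) \<longlonglongrightarrow> v x"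
    using continuous_loop_approx_bounded[of v, OF _ M0 v(1,2)] by auto
  have c: "continuous_on UNIV (c k)" "c k 0 = 0" "c k 1 = 0"
     "x \<in> {0..1} \<Longrightarrow> 0 \<le> c k x \<and> c k x \<le> M" for k x
    using c' by blast+
  have [measurable]: "c k \<in> borel_measurable circ" for k
    by (rule continuous_measurable_circ[OF c(1)])
  have bound: "AE x in circ. norm ((v x - c k x)\<^sup>2) \<le> M\<^sup>2" for k
    using AE_space[of circ]
  proof eventually_elim
    case (elim x)
    hence "\<bar>v x - c k x\<bar> \<le> M" using c(4)[of x k] v[of x] by auto
    hence "\<bar>v x - c k x\<bar>\<^sup>2 \<le> M\<^sup>2" by (intro power_mono) auto
    thus ?case by simp
  qed
  have "(\<lambda>k. \<integral>x. (v x - c k x)\<^sup>2 \<partial>circ) \<longlonglongrightarrow> (\<integral>x. 0 \<partial>circ)"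
  proof (rule integral_dominated_convergence[where w = "\<lambda>x. M\<^sup>2"])
    show "AE x in circ. (\<lambda>k. (v x - c k x)\<^sup>2) \<longlonglongrightarrow> 0"
      using clim
    proof eventually_elim
      case (elim x)
      have "(\<lambda>k. (v x - c k x)\<^sup>2) \<longlonglongrightarrow> (v x - v x)\<^sup>2" by (intro tendsto_intros elim)
      thus ?case by simp
    qed
  qed (use bound in auto)
  hence "eventually (\<lambda>k. (\<integral>x. (v x - c k x)\<^sup>2 \<partial>circ) < e / 12) sequentially"
    using e by (intro order_tendstoD) auto
  then obtain j where j: "(\<integral>x. (v x - c j x)\<^sup>2 \<partial>circ) < e / 12"
    by (auto dest: eventually_happens)
  define \<eta> where "\<eta> = sqrt (e / 12)"
  have \<eta>: "\<eta> > 0" "\<eta>\<^sup>2 = e / 12" using e by (auto simp: \<eta>_def)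
  obtain p where p: "Im (coeff p 0) = 0" "\<forall>x. Re (poly p (circle_point x)) \<ge> 0"
    "\<forall>x\<in>{0..1}. \<bar>c j x - Re (poly p (circle_point x))\<bar> < \<eta>"
    using circle_nonneg_poly_approx[of "c j" \<eta>] c \<eta>
    by (metis continuous_on_subset top_greatest)
  have i1: "integrable circ (\<lambda>x. (w x - v x)\<^sup>2)"
    by (rule Bochner_Integration.integrable_bound[OF w2])
       (use v in \<open>auto intro!: power_mono always_eventually\<close>)
  have i2: "integrable circ (\<lambda>x. (v x - c j x)\<^sup>2)"
    by (rule integrable_circ_bounded[OF _ bound]) measurable
  have "(\<integral>x. (w x - Re (poly p (circle_point x)))\<^sup>2 \<partial>circ) \<le>
        (\<integral>x. 4 * (w x - v x)\<^sup>2 + 4 * (v x - c j x)\<^sup>2 + 2 * \<eta>\<^sup>2 \<partial>circ)"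
  proof (rule Bochner_Integration.integral_mono')
    fix x assume "x \<in> space circ"
    hence "\<bar>c j x - Re (poly p (circle_point x))\<bar> \<le> \<eta>" using p(3) by (auto intro: less_imp_le)
    hence "\<bar>c j x - Re (poly p (circle_point x))\<bar>\<^sup>2 \<le> \<eta>\<^sup>2" by (intro power_mono) auto
    hence "(c j x - Re (poly p (circle_point x)))\<^sup>2 \<le> \<eta>\<^sup>2" by simp
    moreover have "(a + b + d)\<^sup>2 \<le> 4 * a\<^sup>2 + 4 * b\<^sup>2 + 2 * d\<^sup>2" for a b d :: real
      using zero_le_power2[of "a - b"] zero_le_power2[of "a + b - d"]
      by (simp add: power2_eq_square algebra_simps)
    from this[of "w x - v x" "v x - c j x" "c j x - Re (poly p (circle_point x))"]
    have "(w x - Re (poly p (circle_point x)))\<^sup>2 \<le> 4 * (w x - v x)\<^sup>2 + 4 * (v x - c j x)\<^sup>2 +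
      2 * (c j x - Re (poly p (circle_point x)))\<^sup>2" by simp
    ultimately show "(w x - Re (poly p (circle_point x)))\<^sup>2 \<le>
       4 * (w x - v x)\<^sup>2 + 4 * (v x - c j x)\<^sup>2 + 2 * \<eta>\<^sup>2" by linarith
  qed (use i1 i2 in auto)
  also have "\<dots> = 4 * (\<integral>x. (w x - v x)\<^sup>2 \<partial>circ) + 4 * (\<integral>x. (v x - c j x)\<^sup>2 \<partial>circ) + 2 * \<eta>\<^sup>2"
    using i1 i2 by simp
  also have "\<dots> < e" using vw j \<eta> e by simp
  finally show ?thesis using p by blast
qed

text \<open>The mean of p^2 is the square of the real number \<open>coeff p 0\<close>, hence
  nonnegative, and its real part is the mean of Re^2 - Im^2. The constant p = i shows why
  \<open>coeff p 0\<close> has to be real.\<close>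

lemma integral_norm2_poly_circle_le:
  assumes "Im (coeff p 0) = 0"
  shows "(\<integral>x. (norm (poly p (circle_point x)))\<^sup>2 \<partial>circ) \<le> 2 * (\<integral>x. (Re (poly p (circle_point x)))\<^sup>2 \<partial>circ)"
proof -
  let ?P = "\<lambda>x. poly p (circle_point x)"
  obtain B where B: "\<And>x. norm (?P x) \<le> B" using bounded_poly_circle by blast
  have iR: "integrable circ (\<lambda>x. (Re (?P x))\<^sup>2)"
  proof (rule integrable_circ_bounded[where B = "B\<^sup>2"])
    show "AE x in circ. norm ((Re (?P x))\<^sup>2) \<le> B\<^sup>2"
      using power_mono[OF order_trans[OF abs_Re_le_cmod B], where n = 2] by (auto intro!: always_eventually)
  qed measurable
  have iI: "integrable circ (\<lambda>x. (Im (?P x))\<^sup>2)"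
  proof (rule integrable_circ_bounded[where B = "B\<^sup>2"])
    show "AE x in circ. norm ((Im (?P x))\<^sup>2) \<le> B\<^sup>2"
      using power_mono[OF order_trans[OF abs_Im_le_cmod B], where n = 2] by (auto intro!: always_eventually)
  qed measurable
  have "(\<integral>x. poly (p * p) (circle_point x) \<partial>circ) = (coeff p 0)\<^sup>2"
    by (subst integral_poly_circle) (simp add: coeff_mult power2_eq_square)
  hence "Re (\<integral>x. poly (p * p) (circle_point x) \<partial>circ) = (Re (coeff p 0))\<^sup>2"
    using assms by (simp add: Re_power2)
  moreover have "Re (\<integral>x. poly (p * p) (circle_point x) \<partial>circ) = (\<integral>x. Re (poly (p * p) (circle_point x)) \<partial>circ)"
    using integrable_poly_circle by (simp del: poly_mult)
  moreover have "\<dots> = (\<integral>x. (Re (?P x))\<^sup>2 \<partial>circ) - (\<integral>x. (Im (?P x))\<^sup>2 \<partial>circ)"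
    using iR iI by (simp add: power2_eq_square)
  ultimately have "(\<integral>x. (Im (?P x))\<^sup>2 \<partial>circ) \<le> (\<integral>x. (Re (?P x))\<^sup>2 \<partial>circ)"
    by (smt (verit) zero_le_power2)
  thus ?thesis using iR iI by (simp add: cmod_power2)
qed

subsection \<open>Conjugate functions and weighted decompositions\<close>

text \<open>\<open>Y\<close> is \<open>w\<close> plus \<open>\<i>\<close> times its conjugate function; for bounded analytic
  functions \<open>\<integral>Y\<^sup>2 = (\<integral>Y)\<^sup>2\<close> controls the imaginary part by the real part in \<open>L\<^sup>2\<close>.\<close>

lemma exists_analytic_with_real_part:
  assumes [measurable]: "w \<in> borel_measurable circ" and w: "\<And>x. 0 \<le> w x"
    and w2: "integrable circ (\<lambda>x. (w x)\<^sup>2)"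
  obtains Y where "Y \<in> borel_measurable circ" "\<And>x. Re (Y x) = w x"
    "integrable circ (\<lambda>x. (norm (Y x))\<^sup>2)"
    "(\<integral>x. (norm (Y x))\<^sup>2 \<partial>circ) \<le> 4 * (\<integral>x. (w x)\<^sup>2 \<partial>circ)"
    "\<And>\<rho>. \<rho> \<ge> 0 \<Longrightarrow> (\<lambda>x. of_real \<rho> / (of_real \<rho> + Y x)) \<in> H1_multiplier"
proof -
  have "\<forall>k::nat. \<exists>p. Im (coeff p 0) = 0 \<and> (\<forall>x. Re (poly p (circle_point x)) \<ge> 0) \<and>
     (\<integral>x. (w x - Re (poly p (circle_point x)))\<^sup>2 \<partial>circ) < 1 / real (Suc k)"
    by (intro allI L2_nonneg_poly_approx) (use w w2 in auto)
  then obtain p where p: "\<And>k. Im (coeff (p k) 0) = 0" "\<And>k x. Re (poly (p k) (circle_point x)) \<ge> 0"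
    "\<And>k. (\<integral>x. (w x - Re (poly (p k) (circle_point x)))\<^sup>2 \<partial>circ) < 1 / real (Suc k)"
    by metis
  define P where "P k x = poly (p k) (circle_point x)" for k x
  define a where "a k = (\<integral>x. (w x - Re (P k x))\<^sup>2 \<partial>circ)" for k
  have [measurable]: "P k \<in> borel_measurable circ" for k unfolding P_def by measurable
  have bP: "\<exists>B. \<forall>x. norm (P k x) \<le> B" for k unfolding P_def by (rule bounded_poly_circle)
  have P2: "integrable circ (\<lambda>x. (norm (P k x))\<^sup>2)" for k
  proof -
    obtain B where B: "\<And>x. norm (P k x) \<le> B" using bP by blast
    show ?thesis
      using power_mono[OF B, where n = 2] by (intro integrable_circ_bounded[where B = "B\<^sup>2"]) auto
  qed
  have Re2: "integrable circ (\<lambda>x. (Re (P k x))\<^sup>2)" for k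
    by (rule Bochner_Integration.integrable_bound[OF P2[of k]])
       (auto simp: cmod_power2)
  have d2: "integrable circ (\<lambda>x. (w x - Re (P k x))\<^sup>2)" for k
  proof (rule Bochner_Integration.integrable_bound)
    show "integrable circ (\<lambda>x. 2 * (w x)\<^sup>2 + 2 * (Re (P k x))\<^sup>2)" using w2 Re2 by auto
    have "(u - v)\<^sup>2 \<le> 2 * u\<^sup>2 + 2 * v\<^sup>2" for u v :: real
      using zero_le_power2[of "u + v"] by (simp add: power2_eq_square algebra_simps)
    thus "AE x in circ. norm ((w x - Re (P k x))\<^sup>2) \<le> norm (2 * (w x)\<^sup>2 + 2 * (Re (P k x))\<^sup>2)"
      by (auto intro!: always_eventually)
  qed measurable
  have a0: "a k \<ge> 0" "a k < 1 / real (Suc k)" for k using p(3)[of k] by (auto simp: a_def P_def)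
  have a_lim: "a \<longlonglongrightarrow> 0"
    by (rule tendsto_sandwich[OF _ _ tendsto_const LIMSEQ_inverse_real_of_nat])
       (use a0 in \<open>auto simp: inverse_eq_divide intro: less_imp_le always_eventually\<close>)
  have sq3: "(u - v)\<^sup>2 \<le> 2 * (z - u)\<^sup>2 + 2 * (z - v)\<^sup>2" for u v z :: real
    using zero_le_power2[of "(z - u) + (z - v)"] by (simp add: power2_eq_square algebra_simps)
  \<comment> \<open>The L^2 estimate applies to \<open>p i - p j\<close>, whose constant coefficient
    is again real; so convergence of the real parts makes the whole sequence Cauchy.\<close>
  have Pdiff: "(\<integral>x. norm (P i x - P j x) \<partial>circ)\<^sup>2 \<le> 4 * (a i + a j)" for i j
  proof -
    have 0: "P i x - P j x = poly (p i - p j) (circle_point x)" for x by (simp add: P_def)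
    obtain B where B: "\<And>x. norm (P i x - P j x) \<le> B" unfolding 0 using bounded_poly_circle by blast
    have i2: "integrable circ (\<lambda>x. (norm (P i x - P j x))\<^sup>2)"
      using power_mono[OF B, where n = 2] by (intro integrable_circ_bounded[where B = "B\<^sup>2"]) auto
    have "(\<integral>x. norm (P i x - P j x) \<partial>circ)\<^sup>2 \<le> (\<integral>x. (norm (P i x - P j x))\<^sup>2 \<partial>circ)"
      by (rule circ_L2_imp_L1) (use i2 in auto)
    also have "\<dots> \<le> 2 * (\<integral>x. (Re (P i x - P j x))\<^sup>2 \<partial>circ)"
      unfolding 0 by (rule integral_norm2_poly_circle_le) (simp add: p)
    also have "(\<integral>x. (Re (P i x - P j x))\<^sup>2 \<partial>circ) \<le>
       (\<integral>x. 2 * (w x - Re (P i x))\<^sup>2 + 2 * (w x - Re (P j x))\<^sup>2 \<partial>circ)"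
      by (rule Bochner_Integration.integral_mono') (use d2 sq3 in auto)
    also have "\<dots> = 2 * (a i + a j)" using d2 by (simp add: a_def)
    finally show ?thesis by simp
  qed
  have iP: "integrable circ (P k)" for k unfolding P_def by (rule integrable_poly_circle)
  have cau: "\<exists>N. \<forall>i\<ge>N. \<forall>j\<ge>N. (\<integral>x. norm (P i x - P j x) \<partial>circ) < e" if e: "e > 0" for e
  proof -
    have "eventually (\<lambda>k. a k < e\<^sup>2 / 8) sequentially"
      using a_lim e by (intro order_tendstoD) auto
    then obtain N where N: "\<And>k. k \<ge> N \<Longrightarrow> a k < e\<^sup>2 / 8" by (auto simp: eventually_sequentially)
    have "(\<integral>x. norm (P i x - P j x) \<partial>circ) < e" if "i \<ge> N" "j \<ge> N" for i j
    proof -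
      have "a i + a j < e\<^sup>2 / 8 + e\<^sup>2 / 8" by (intro add_strict_mono N that)
      hence "4 * (a i + a j) < e\<^sup>2" by simp
      with Pdiff[of i j] have "(\<integral>x. norm (P i x - P j x) \<partial>circ)\<^sup>2 < e\<^sup>2"
        by (rule order_le_less_trans)
      thus ?thesis using e by (simp add: power2_less_imp_less)
    qed
    thus ?thesis by blast
  qed
  obtain Z where Z: "integrable circ Z" "(\<lambda>n. \<integral>x. norm (P n x - Z x) \<partial>circ) \<longlonglongrightarrow> 0"
    using L1_Cauchy_limit[OF iP cau] by blast
  have [measurable]: "Z \<in> borel_measurable circ" using Z by auto
  have iPZ: "integrable circ (\<lambda>x. P n x - Z x)" for n using iP Z by auto
  obtain r where r: "strict_mono r" "AE x in circ. (\<lambda>n. P (r n) x - Z x) \<longlonglongrightarrow> 0"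
    using tendsto_L1_AE_subseq[OF iPZ Z(2)] by blast
  have iw: "integrable circ w" by (rule circ_L2_imp_L1) (use w2 in auto)
  have ReZ: "AE x in circ. Re (Z x) = w x"
  proof -
    have iZw: "integrable circ (\<lambda>x. \<bar>w x - Re (Z x)\<bar>)" using iw Z by auto
    have "(\<integral>x. \<bar>w x - Re (Z x)\<bar> \<partial>circ) \<le> sqrt (a k) + (\<integral>x. norm (P k x - Z x) \<partial>circ)" for k
    proof -
      have "(\<integral>x. \<bar>w x - Re (Z x)\<bar> \<partial>circ) \<le> (\<integral>x. \<bar>w x - Re (P k x)\<bar> + norm (P k x - Z x) \<partial>circ)"
      proof (rule Bochner_Integration.integral_mono')
        show "\<bar>w x - Re (Z x)\<bar> \<le> \<bar>w x - Re (P k x)\<bar> + norm (P k x - Z x)" for x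
          using abs_Re_le_cmod[of "P k x - Z x"] by simp
      qed (use iw iP iPZ in auto)
      also have "\<dots> = (\<integral>x. \<bar>w x - Re (P k x)\<bar> \<partial>circ) + (\<integral>x. norm (P k x - Z x) \<partial>circ)"
        by (rule Bochner_Integration.integral_add) (use iw iP iPZ in auto)
      also have "(\<integral>x. \<bar>w x - Re (P k x)\<bar> \<partial>circ) \<le> sqrt (a k)"
        using circ_L2_imp_L1(2)[of "\<lambda>x. w x - Re (P k x)"] d2[of k]
        by (intro real_le_rsqrt) (auto simp: a_def)
      finally show ?thesis by simp
    qed
    moreover have "(\<lambda>k. sqrt (a k) + (\<integral>x. norm (P k x - Z x) \<partial>circ)) \<longlonglongrightarrow> sqrt 0 + 0"
      by (intro tendsto_intros a_lim Z)
    ultimately have "(\<integral>x. \<bar>w x - Re (Z x)\<bar> \<partial>circ) \<le> 0"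
      by (intro LIMSEQ_le_const[where X = "\<lambda>k. sqrt (a k) + (\<integral>x. norm (P k x - Z x) \<partial>circ)"]) auto
    moreover have "(\<integral>x. \<bar>w x - Re (Z x)\<bar> \<partial>circ) \<ge> 0" by simp
    ultimately have "(\<integral>x. \<bar>w x - Re (Z x)\<bar> \<partial>circ) = 0" by linarith
    hence "AE x in circ. \<bar>w x - Re (Z x)\<bar> = 0"
      using integral_nonneg_eq_0_iff_AE[OF iZw] by simp
    thus ?thesis by eventually_elim simp
  qed
  \<comment> \<open>\<open>Z\<close> has real part \<open>w\<close> only almost everywhere; the
    correction makes this true at every point, as the pointwise bounds on the resolvents
    demand.\<close>
  define Y where "Y x = Complex (w x) (Im (Z x))" for x
  have "(\<lambda>x. complex_of_real (w x) + \<i> * complex_of_real (Im (Z x))) \<in> borel_measurable circ"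
    by measurable
  moreover have "Y = (\<lambda>x. complex_of_real (w x) + \<i> * complex_of_real (Im (Z x)))"
    by (simp add: fun_eq_iff Y_def Complex_eq)
  ultimately have Ym [measurable]: "Y \<in> borel_measurable circ" by simp
  have lim: "AE x in circ. (\<lambda>n. P (r n) x) \<longlonglongrightarrow> Y x"
    using r(2) ReZ
  proof eventually_elim
    case (elim x)
    have "Y x = Z x" using elim by (simp add: Y_def complex_eq_iff)
    thus ?case using elim by (simp add: LIM_zero_iff)
  qed
  have lim2: "AE x in circ. (\<lambda>n. (norm (P (r n) x))\<^sup>2) \<longlonglongrightarrow> (norm (Y x))\<^sup>2"
    using lim by eventually_elim (intro tendsto_intros)
  \<comment> \<open>One factor 2 comes from \<open>integral_norm2_poly_circle_le\<close>, the other
    from comparing \<open>P k\<close> with \<open>w\<close> by \<open>sq3\<close>.\<close>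
  have W: "(\<integral>x. (norm (P k x))\<^sup>2 \<partial>circ) \<le> 4 * (\<integral>x. (w x)\<^sup>2 \<partial>circ) + 4 * a k" for k
  proof -
    have "(\<integral>x. (norm (P k x))\<^sup>2 \<partial>circ) \<le> 2 * (\<integral>x. (Re (P k x))\<^sup>2 \<partial>circ)"
      unfolding P_def by (rule integral_norm2_poly_circle_le) (rule p)
    also have "(\<integral>x. (Re (P k x))\<^sup>2 \<partial>circ) \<le> (\<integral>x. 2 * (w x)\<^sup>2 + 2 * (w x - Re (P k x))\<^sup>2 \<partial>circ)"
    proof (rule Bochner_Integration.integral_mono')
      show "(Re (P k x))\<^sup>2 \<le> 2 * (w x)\<^sup>2 + 2 * (w x - Re (P k x))\<^sup>2" for x
        using sq3[of 0 "Re (P k x)" "w x"] by simp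
    qed (use w2 d2 in auto)
    also have "\<dots> = 2 * (\<integral>x. (w x)\<^sup>2 \<partial>circ) + 2 * a k" using w2 d2 by (simp add: a_def)
    finally show ?thesis by simp
  qed
  have clim: "(\<lambda>n. 4 * (\<integral>x. (w x)\<^sup>2 \<partial>circ) + 4 * a (r n)) \<longlonglongrightarrow> 4 * (\<integral>x. (w x)\<^sup>2 \<partial>circ)"
    using tendsto_add[OF tendsto_const tendsto_mult[OF tendsto_const LIMSEQ_subseq_LIMSEQ[OF a_lim r(1)]],
      of "4 * (\<integral>x. (w x)\<^sup>2 \<partial>circ)" 4] by (simp add: o_def)
  note Fat = Fatou_integral[OF P2 _ _ lim2 W clim]
  have \<phi>: "(\<lambda>x. of_real \<rho> / (of_real \<rho> + Y x)) \<in> H1_multiplier" if "\<rho> \<ge> 0" for \<rho>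
  proof (cases "\<rho> = 0")
    \<comment> \<open>A weight may be zero. The quotient then vanishes identically, also at zeros of
      \<open>Y\<close>, because division by 0 gives 0.\<close>
    case True
    thus ?thesis using H1_multiplier_const[of 0] by simp
  next
    case False
    with that have \<rho>: "\<rho> > 0" by simp
    have nb: "norm (of_real \<rho> / (of_real \<rho> + y)) \<le> 1" if "Re y \<ge> 0" for y
    proof -
      have "\<rho> \<le> Re (of_real \<rho> + y)" using that by simp
      also have "\<dots> \<le> norm (of_real \<rho> + y)" by (rule complex_Re_le_cmod)
      finally show ?thesis using \<rho> by (simp add: norm_divide divide_simps)
    qed
    show ?thesis
    proof (rule H1_multiplier_limit[where s = "\<lambda>n x. of_real \<rho> / (of_real \<rho> + P (r n) x)" and B = 1])
      show "(\<lambda>x. of_real \<rho> / (of_real \<rho> + P (r n) x)) \<in> H1_multiplier" for n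
        using p \<rho> unfolding P_def
        by (intro H1_multiplier_resolvent H1_multiplier_poly) auto
      show "AE x in circ. (\<lambda>n. of_real \<rho> / (of_real \<rho> + P (r n) x)) \<longlonglongrightarrow> of_real \<rho> / (of_real \<rho> + Y x)"
        using lim
      proof eventually_elim
        case (elim x)
        have "Re (of_real \<rho> + Y x) > 0" using \<rho> w[of x] by (simp add: Y_def)
        hence "of_real \<rho> + Y x \<noteq> 0" by (metis less_irrefl zero_complex.sel(1))
        thus ?case by (intro tendsto_intros elim)
      qed
      show "norm (of_real \<rho> / (of_real \<rho> + P (r n) x)) \<le> 1" for n x
        using p(2) by (intro nb) (simp add: P_def)
      show "norm (of_real \<rho> / (of_real \<rho> + Y x)) \<le> 1" for x
        using w by (intro nb) (simp add: Y_def)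
    qed measurable
  qed
  show ?thesis
  proof (rule that[of Y])
    show "Re (Y x) = w x" for x by (simp add: Y_def)
  qed (use Fat \<phi> in auto)
qed

section \<open>Testing the hypothesis against truncated weights\<close>

text \<open>A layer of height \<open>c\<close>, the smallest weight, is peeled off: \<open>y\<close>
  splits into \<open>min c y\<close> and the rest \<open>y'\<close>. On the layer all weights are
  equal, and the hypothesis bounds its share by c |E| plus the integral of \<open>min c y\<close>
  over t. In the rest every weight has dropped by \<open>c\<close>, so an index of smallest weight
  disappears and induction on |E| applies.\<close>

lemma sum_integral_min_le:
  fixes a :: "'n \<Rightarrow> real \<Rightarrow> real"
  assumes t: "t > 0" and a: "\<And>n. integrable circ (a n)" "\<And>n x. a n x \<ge> 0"
    and hyp: "\<And>E F. finite E \<Longrightarrow> F \<in> sets circ \<Longrightarrow>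
        (\<Sum>n\<in>E. (\<integral>x\<in>F. a n x \<partial>circ)) \<le> max (real (card E)) (measure circ F / t)"
    and E: "finite E" and X: "\<And>n. n \<in> E \<Longrightarrow> X n \<ge> 0"
    and y: "integrable circ y" "\<And>x. y x \<ge> 0"
  shows "(\<Sum>n\<in>E. \<integral>x. a n x * min (X n) (y x) \<partial>circ) \<le> (\<Sum>n\<in>E. X n) + (\<integral>x. y x \<partial>circ) / t"
proof -
  have am [measurable]: "a n \<in> borel_measurable circ" for n using a by auto
  \<comment> \<open>The maximum is at most the sum of its two terms, and
    \<open>measure circ F / t\<close> cancels against the 1 / t subtracted on
    \<open>F\<close>.\<close>
  have excess: "(\<integral>x. max 0 ((\<Sum>n\<in>E. a n x) - 1 / t) \<partial>circ) \<le> card E" if "finite E" for E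
  proof -
    define F where "F = {x \<in> space circ. (\<Sum>n\<in>E. a n x) > 1 / t}"
    have F: "F \<in> sets circ" unfolding F_def by measurable
    have [simp]: "F \<inter> {0..1} = F" by (auto simp: F_def)
    have ia: "integrable circ (\<lambda>x. indicator F x * a n x)" for n
      using integrable_mult_indicator[OF F a(1)[of n]] by simp
    have "(\<integral>x. max 0 ((\<Sum>n\<in>E. a n x) - 1 / t) \<partial>circ) =
        (\<integral>x. (\<Sum>n\<in>E. indicator F x * a n x) - indicator F x * (1 / t) \<partial>circ)"
      by (intro Bochner_Integration.integral_cong refl)
         (auto simp: F_def indicator_def max_def)
    also have "\<dots> = (\<Sum>n\<in>E. \<integral>x. indicator F x * a n x \<partial>circ) - measure circ F / t"
      using ia F by (subst Bochner_Integration.integral_diff) (auto simp: circ.emeasure_eq_measure)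
    also have "(\<Sum>n\<in>E. \<integral>x. indicator F x * a n x \<partial>circ) = (\<Sum>n\<in>E. (\<integral>x\<in>F. a n x \<partial>circ))"
      by (simp add: set_lebesgue_integral_def)
    also have "\<dots> \<le> max (real (card E)) (measure circ F / t)" by (rule hyp[OF that F])
    also have "\<dots> \<le> card E + measure circ F / t" using t by simp
    finally show ?thesis by simp
  qed
  show ?thesis using E X y
  proof (induction "card E" arbitrary: E X y)
    case 0
    thus ?case using t by simp
  next
    case (Suc k)
    note y = \<open>integrable circ y\<close> \<open>\<And>x. 0 \<le> y x\<close>
    have [measurable]: "y \<in> borel_measurable circ" using y by auto
    have ne: "E \<noteq> {}" using Suc by auto
    define c where "c = Min (X ` E)"
    have "c \<in> X ` E" unfolding c_def using Suc.prems ne by (intro Min_in) auto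
    then obtain m where m: "m \<in> E" "X m = c" by auto
    have c: "c \<le> X n" if "n \<in> E" for n unfolding c_def using that Suc.prems by auto
    have c0: "c \<ge> 0" using m Suc.prems(2) by auto
    define y' where "y' x = max 0 (y x - c)" for x
    have y': "integrable circ y'" "\<And>x. y' x \<ge> 0" using y by (auto simp: y'_def[abs_def])
    have ym: "integrable circ (\<lambda>x. min c (y x))" using y by auto
    have imin: "integrable circ (\<lambda>x. a n x * min d (z x))"
      if "d \<ge> 0" "z \<in> borel_measurable circ" "\<And>x. z x \<ge> 0" for n d and z :: "real \<Rightarrow> real"
    proof (rule Bochner_Integration.integrable_bound)
      show "integrable circ (\<lambda>x. d * a n x)" using a by auto
      have "a n x * min d (z x) \<le> a n x * d" for x using a by (intro mult_left_mono) auto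
      thus "AE x in circ. norm (a n x * min d (z x)) \<le> norm (d * a n x)"
        using a that by (auto simp: abs_mult mult.commute intro!: always_eventually)
    qed (use that in measurable)
    have split: "(\<integral>x. a n x * min (X n) (y x) \<partial>circ) =
        (\<integral>x. a n x * min c (y x) \<partial>circ) + (\<integral>x. a n x * min (X n - c) (y' x) \<partial>circ)" if "n \<in> E" for n
    proof -
      have "a n x * min (X n) (y x) = a n x * min c (y x) + a n x * min (X n - c) (y' x)" for x
      proof -
        have "min (X n) (y x) = min c (y x) + min (X n - c) (y' x)"
          using c[OF that] y(2)[of x] c0 by (auto simp: y'_def min_def max_def)
        thus ?thesis by (simp add: algebra_simps)
      qed
      thus ?thesis using imin[of c y n] imin[of "X n - c" y' n] c[OF that] c0 y y' by auto
    qed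
    have first: "(\<Sum>n\<in>E. \<integral>x. a n x * min c (y x) \<partial>circ) \<le> card E * c + (\<integral>x. min c (y x) \<partial>circ) / t"
    proof -
      let ?A = "\<lambda>x. \<Sum>n\<in>E. a n x"
      have ie: "integrable circ (\<lambda>x. max 0 (?A x - 1 / t))" using a by auto
      have "(\<Sum>n\<in>E. \<integral>x. a n x * min c (y x) \<partial>circ) = (\<integral>x. ?A x * min c (y x) \<partial>circ)"
        using imin[of c y] c0 y by (simp add: sum_distrib_right)
      also have "\<dots> \<le> (\<integral>x. c * max 0 (?A x - 1 / t) + min c (y x) / t \<partial>circ)"
      proof (rule Bochner_Integration.integral_mono')
        fix x
        have mc: "0 \<le> min c (y x)" "min c (y x) \<le> c" using c0 y by auto
        have "?A x * min c (y x) \<le> (max 0 (?A x - 1 / t) + 1 / t) * min c (y x)"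
          using mc by (intro mult_right_mono) auto
        also have "\<dots> = max 0 (?A x - 1 / t) * min c (y x) + min c (y x) / t"
          by (simp add: algebra_simps)
        also have "\<dots> \<le> max 0 (?A x - 1 / t) * c + min c (y x) / t"
          using mc by (intro add_mono mult_left_mono) auto
        finally show "?A x * min c (y x) \<le> c * max 0 (?A x - 1 / t) + min c (y x) / t"
          by (simp add: mult.commute)
        show "0 \<le> c * max 0 (?A x - 1 / t) + min c (y x) / t" using mc c0 t by auto
      qed (use ie ym in auto)
      also have "\<dots> = c * (\<integral>x. max 0 (?A x - 1 / t) \<partial>circ) + (\<integral>x. min c (y x) \<partial>circ) / t"
        using ie ym by simp
      also have "\<dots> \<le> c * card E + (\<integral>x. min c (y x) \<partial>circ) / t"
        using excess[OF Suc.prems(1)] c0 by (intro add_mono mult_left_mono) auto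
      finally show ?thesis by (simp add: mult.commute)
    qed
    have IH: "(\<Sum>n\<in>E - {m}. \<integral>x. a n x * min (X n - c) (y' x) \<partial>circ) \<le>
       (\<Sum>n\<in>E - {m}. X n - c) + (\<integral>x. y' x \<partial>circ) / t"
      by (rule Suc.hyps(1)) (use Suc.hyps(2) Suc.prems(1) m c y' in auto)
    have second: "(\<Sum>n\<in>E. \<integral>x. a n x * min (X n - c) (y' x) \<partial>circ) \<le>
       (\<Sum>n\<in>E. X n - c) + (\<integral>x. y' x \<partial>circ) / t"
    proof -
      have "(\<lambda>x. a m x * min (X m - c) (y' x)) = (\<lambda>x. 0)" using m y'(2) by (auto simp: fun_eq_iff)
      hence "(\<integral>x. a m x * min (X m - c) (y' x) \<partial>circ) = 0" by simp
      thus ?thesis using IH m Suc.prems(1) by (simp add: sum.remove[of E m])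
    qed
    have "(\<integral>x. y x \<partial>circ) = (\<integral>x. min c (y x) + y' x \<partial>circ)"
      by (intro Bochner_Integration.integral_cong) (auto simp: y'_def)
    also have "\<dots> = (\<integral>x. min c (y x) \<partial>circ) + (\<integral>x. y' x \<partial>circ)" using ym y' by simp
    finally have yy: "(\<integral>x. y x \<partial>circ) = (\<integral>x. min c (y x) \<partial>circ) + (\<integral>x. y' x \<partial>circ)" .
    have "(\<Sum>n\<in>E. \<integral>x. a n x * min (X n) (y x) \<partial>circ) =
        (\<Sum>n\<in>E. \<integral>x. a n x * min c (y x) \<partial>circ) + (\<Sum>n\<in>E. \<integral>x. a n x * min (X n - c) (y' x) \<partial>circ)"
      by (simp add: split sum.distrib)
    also have "\<dots> \<le> (card E * c + (\<integral>x. min c (y x) \<partial>circ) / t) + ((\<Sum>n\<in>E. X n - c) + (\<integral>x. y' x \<partial>circ) / t)"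
      using first second by (rule add_mono)
    also have "\<dots> = (\<Sum>n\<in>E. X n) + (\<integral>x. y x \<partial>circ) / t"
      by (simp add: yy sum_subtractf add_divide_distrib)
    finally show ?case .
  qed
qed

text \<open>Re Y \<ge> 0 makes |\<rho> + Y| dominate both \<rho> and |Y|, so |\<phi>| |Y| \<le>
  \<rho> and \<rho> |1 - \<phi>| \<le> |Y|. Each of \<psi> and 1 - \<psi> contains such a factor
  twice; 3 and 4 bound the norms of the cofactors \<open>2 - \<phi>\<^sup>2\<close> and
  \<open>(1 + \<phi>)\<^sup>2\<close>.\<close>

lemma resolvent_cutoff_bounds:
  fixes Y :: complex
  assumes \<rho>: "\<rho> \<ge> 0" and Y: "Re Y \<ge> 0"
  defines "\<phi> \<equiv> of_real \<rho> / (of_real \<rho> + Y)"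
  defines "\<psi> \<equiv> 1 - (1 - \<phi>\<^sup>2)\<^sup>2"
  shows "norm \<psi> * (norm Y)\<^sup>2 \<le> 3 * min (\<rho>\<^sup>2) ((norm Y)\<^sup>2)"
    and "\<rho>\<^sup>2 * norm (1 - \<psi>) \<le> 4 * min (\<rho>\<^sup>2) ((norm Y)\<^sup>2)"
proof -
  have \<psi>: "\<psi> = \<phi>\<^sup>2 * (2 - \<phi>\<^sup>2)" by (simp add: \<psi>_def power2_eq_square algebra_simps)
  have \<psi>': "1 - \<psi> = (1 - \<phi>)\<^sup>2 * (1 + \<phi>)\<^sup>2" by (simp add: \<psi>_def power2_eq_square algebra_simps)
  have "norm \<psi> * (norm Y)\<^sup>2 \<le> 3 * min (\<rho>\<^sup>2) ((norm Y)\<^sup>2) \<and>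
        \<rho>\<^sup>2 * norm (1 - \<psi>) \<le> 4 * min (\<rho>\<^sup>2) ((norm Y)\<^sup>2)"
  proof (cases "\<rho> = 0")
    case True
    thus ?thesis by (simp add: \<psi> \<phi>_def)
  next
    case False
    with \<rho> have \<rho>: "\<rho> > 0" by simp
    let ?s = "of_real \<rho> + Y"
    have s2: "(norm ?s)\<^sup>2 = \<rho>\<^sup>2 + 2 * \<rho> * Re Y + (norm Y)\<^sup>2"
      unfolding cmod_power2 by (simp add: power2_eq_square algebra_simps)
    have "2 * \<rho> * Re Y \<ge> 0" using \<rho> Y by simp
    hence "\<rho>\<^sup>2 \<le> (norm ?s)\<^sup>2" "(norm Y)\<^sup>2 \<le> (norm ?s)\<^sup>2" unfolding s2
      using zero_le_power2[of "norm Y"] zero_le_power2[of \<rho>] by linarith+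
    hence s: "\<rho> \<le> norm ?s" "norm Y \<le> norm ?s" by (auto dest: power2_le_imp_le)
    have s0: "norm ?s > 0" "?s \<noteq> 0" using s(1) \<rho> by auto
    have 1: "1 - \<phi> = Y / ?s" using s0 by (simp add: \<phi>_def field_simps)
    have n\<phi>: "norm \<phi> = \<rho> / norm ?s" using \<rho> by (simp add: \<phi>_def norm_divide)
    have n1: "norm (1 - \<phi>) = norm Y / norm ?s" by (simp add: 1 norm_divide)
    have b: "norm \<phi> \<le> 1" "norm (1 - \<phi>) \<le> 1"
      unfolding n\<phi> n1 using s s0 by simp_all
    have c: "norm \<phi> * norm Y \<le> \<rho>" "\<rho> * norm (1 - \<phi>) \<le> norm Y"
      unfolding n\<phi> n1 using s s0 \<rho> by (auto simp: divide_simps intro: mult_left_mono)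
       (metis mult.commute mult_left_mono norm_ge_zero)
    have b2: "(norm \<phi>)\<^sup>2 \<le> 1" "(norm (1 - \<phi>))\<^sup>2 \<le> 1" using b by (auto intro: power_le_one)
    have c2: "(norm \<phi>)\<^sup>2 * (norm Y)\<^sup>2 \<le> \<rho>\<^sup>2" "\<rho>\<^sup>2 * (norm (1 - \<phi>))\<^sup>2 \<le> (norm Y)\<^sup>2"
      using power_mono[OF c(1), of 2] power_mono[OF c(2), of 2] \<rho> by (auto simp: power_mult_distrib)
    have "norm (2 - \<phi>\<^sup>2) \<le> 2 + (norm \<phi>)\<^sup>2"
      using norm_triangle_ineq4[of 2 "\<phi>\<^sup>2"] by (simp add: norm_power)
    hence "norm (2 - \<phi>\<^sup>2) \<le> 3" using b2 by linarith
    hence "norm \<psi> \<le> (norm \<phi>)\<^sup>2 * 3" unfolding \<psi> norm_mult norm_power by (intro mult_left_mono) auto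
    hence "norm \<psi> * (norm Y)\<^sup>2 \<le> (norm \<phi>)\<^sup>2 * 3 * (norm Y)\<^sup>2" by (intro mult_right_mono) auto
    also have "\<dots> = 3 * ((norm \<phi>)\<^sup>2 * (norm Y)\<^sup>2)" by simp
    also have "(norm \<phi>)\<^sup>2 * (norm Y)\<^sup>2 \<le> min (\<rho>\<^sup>2) ((norm Y)\<^sup>2)"
      using c2 mult_right_mono[OF b2(1), of "(norm Y)\<^sup>2"] by simp
    finally have A: "norm \<psi> * (norm Y)\<^sup>2 \<le> 3 * min (\<rho>\<^sup>2) ((norm Y)\<^sup>2)" by simp
    have "norm (1 + \<phi>) \<le> 2" using norm_triangle_ineq[of 1 \<phi>] b by simp
    hence "(norm (1 + \<phi>))\<^sup>2 \<le> 4" using power_mono[of "norm (1 + \<phi>)" 2 2] by simp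
    hence "norm (1 - \<psi>) \<le> (norm (1 - \<phi>))\<^sup>2 * 4" unfolding \<psi>' norm_mult norm_power by (intro mult_left_mono) auto
    hence "\<rho>\<^sup>2 * norm (1 - \<psi>) \<le> \<rho>\<^sup>2 * ((norm (1 - \<phi>))\<^sup>2 * 4)" by (intro mult_left_mono) auto
    also have "\<dots> = 4 * (\<rho>\<^sup>2 * (norm (1 - \<phi>))\<^sup>2)" by simp
    also have "\<rho>\<^sup>2 * (norm (1 - \<phi>))\<^sup>2 \<le> min (\<rho>\<^sup>2) ((norm Y)\<^sup>2)"
      using c2 mult_left_mono[OF b2(2), of "\<rho>\<^sup>2"] by simp
    finally show ?thesis using A by simp
  qed
  thus "norm \<psi> * (norm Y)\<^sup>2 \<le> 3 * min (\<rho>\<^sup>2) ((norm Y)\<^sup>2)"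
    "\<rho>\<^sup>2 * norm (1 - \<psi>) \<le> 4 * min (\<rho>\<^sup>2) ((norm Y)\<^sup>2)" by auto
qed

section \<open>The threshold and the convexity of the squared excess\<close>

text \<open>The threshold only has to exceed the constant 28 of \<open>weighted_decomposition\<close>.\<close>

definition excess :: "real \<Rightarrow> real" where
  "excess r = max 0 (r - 29)"

lemma excess_nonneg [simp]: "0 \<le> excess r"
  by (simp add: excess_def)

lemma excess_measurable [measurable]: "excess \<in> borel_measurable borel"
  unfolding excess_def by measurable

lemma excess_mono: "r \<le> s \<Longrightarrow> excess r \<le> excess s"
  by (simp add: excess_def)

lemma excess_le: "0 \<le> r \<Longrightarrow> excess r \<le> r"
  by (simp add: excess_def)

lemma excess_add_le: "excess (r + d) \<le> excess r + \<bar>d\<bar>"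
  by (simp add: excess_def)

text \<open>First-order bound with quadratic remainder for the convex function
  \<open>(excess r)\<^sup>2\<close>, whose derivative is \<open>2 * excess r\<close>. The 29 enters
  because \<open>excess r\<close> vanishes unless r exceeds 29, so that
  \<open>29 * excess r \<le> excess r * r\<close>.\<close>

lemma excess_sq_convex_step:
  assumes "0 \<le> \<epsilon>" "r' \<le> (1 - \<epsilon>) * r + \<epsilon> * s"
  shows "(excess r')\<^sup>2 \<le> (excess r)\<^sup>2 + 2 * \<epsilon> * (excess r * s - 29 * excess r) + \<epsilon>\<^sup>2 * (s - r)\<^sup>2"
proof -
  define d where "d = \<epsilon> * (s - r)"
  have "r' \<le> r + d" using assms by (simp add: d_def algebra_simps)
  hence "(excess r')\<^sup>2 \<le> (excess (r + d))\<^sup>2" by (intro power_mono excess_mono) auto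
  also have "\<dots> \<le> (excess r)\<^sup>2 + 2 * excess r * d + d\<^sup>2"
  proof (cases "r + d \<le> 29")
    case True
    hence "(excess (r + d))\<^sup>2 = 0" by (simp add: excess_def)
    also have "0 \<le> (excess r + d)\<^sup>2" by simp
    finally show ?thesis by (simp add: power2_sum)
  next
    case False
    show ?thesis
    proof (cases "r \<ge> 29")
      case True
      have "excess (r + d) = excess r + d" using True False by (simp add: excess_def)
      thus ?thesis by (simp add: power2_sum)
    next
      case r: False
      have "excess r = 0" "0 \<le> excess (r + d)" "excess (r + d) \<le> d"
        using r False by (auto simp: excess_def)
      thus ?thesis using power_mono[of "excess (r + d)" d 2] by simp
    qed
  qed
  finally have 1: "(excess r')\<^sup>2 \<le> (excess r)\<^sup>2 + 2 * (excess r * d) + d\<^sup>2" by simp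
  have "29 * excess r \<le> excess r * r"
    using mult_right_mono[of 29 r "r - 29"]
    by (cases "r \<ge> 29") (auto simp: excess_def max_def mult.commute)
  hence "\<epsilon> * (excess r * s - excess r * r) \<le> \<epsilon> * (excess r * s - 29 * excess r)"
    using assms(1) by (intro mult_left_mono) auto
  hence "excess r * d \<le> \<epsilon> * (excess r * s - 29 * excess r)" by (simp add: d_def algebra_simps)
  with 1 show ?thesis by (simp add: d_def power_mult_distrib)
qed

section \<open>The decomposition for fixed weights\<close>

text \<open>\<open>E\<close> is finite because \<open>card\<close> is 0 on infinite sets, where the
  intended bound is infinite.\<close>

locale bounded_H1_sequence =
  fixes f :: "nat \<Rightarrow> real \<Rightarrow> complex" and t :: real
  assumes f_H1: "f n \<in> H1" and t_pos: "t > 0"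
    and sum_bound: "finite E \<Longrightarrow> F \<in> sets circ \<Longrightarrow>
        (\<Sum>n\<in>E. (\<integral>x\<in>F. norm (f n x) \<partial>circ)) \<le> max (real (card E)) (measure circ F / t)"
begin

lemma f_integrable: "integrable circ (f n)"
  using f_H1 H1_integrable by blast

lemma f_measurable [measurable]: "f n \<in> borel_measurable circ"
  using f_H1 H1_measurable by blast

text \<open>The parameter \<delta> trades boundedness against accuracy: as it tends to 0 the
  pointwise bound on \<open>h\<close> blows up and the last error term vanishes. Boundedness is what
  admits \<open>h\<close> as a competitor for the penalty.\<close>

lemma weighted_decomposition:
  assumes X: "\<And>n. X n \<ge> 0" and y: "integrable circ y" "\<And>x. y x \<ge> 0" and \<delta>: "\<delta> > 0"
  obtains h where "\<And>n. h n \<in> H1" "\<And>n x. n < N \<Longrightarrow> norm (h n x) \<le> 3 * X n / \<delta>"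
    "(\<Sum>n<N. X n * (\<integral>x. norm (f n x - h n x) \<partial>circ)) + (\<integral>x. y x * (\<Sum>n<N. norm (h n x)) \<partial>circ)
      \<le> 28 * ((\<Sum>n<N. X n) + (\<integral>x. y x \<partial>circ) / t + \<delta> * (\<Sum>n<N. \<integral>x. norm (f n x) \<partial>circ) / t)"
proof -
  \<comment> \<open>The extra term makes \<open>\<delta> * norm (f n x)\<close> at most |Y|^2, so
    the bound on |\<psi>| |Y|^2 also controls |\<psi> f_n| pointwise.\<close>
  define W where "W x = y x + \<delta> * (\<Sum>n<N. norm (f n x))" for x
  have W0: "W x \<ge> 0" for x using y \<delta> by (auto simp: W_def intro!: add_nonneg_nonneg mult_nonneg_nonneg sum_nonneg)
  have Wi: "integrable circ W" unfolding W_def using y f_integrable by auto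
  have [measurable]: "W \<in> borel_measurable circ" "y \<in> borel_measurable circ" using Wi y by auto
  obtain Y where Ym [measurable]: "Y \<in> borel_measurable circ" and ReY: "\<And>x. Re (Y x) = sqrt (W x)"
    and Y2: "integrable circ (\<lambda>x. (norm (Y x))\<^sup>2)"
    and Yint: "(\<integral>x. (norm (Y x))\<^sup>2 \<partial>circ) \<le> 4 * (\<integral>x. (sqrt (W x))\<^sup>2 \<partial>circ)"
    and \<phi>: "\<And>\<rho>. \<rho> \<ge> 0 \<Longrightarrow> (\<lambda>x. of_real \<rho> / (of_real \<rho> + Y x)) \<in> H1_multiplier"
    by (rule exists_analytic_with_real_part[of "\<lambda>x. sqrt (W x)"]) (use W0 Wi in auto)
  have WY: "W x \<le> (norm (Y x))\<^sup>2" for x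
  proof -
    have "sqrt (W x) \<le> norm (Y x)" using complex_Re_le_cmod[of "Y x"] by (simp add: ReY)
    hence "(sqrt (W x))\<^sup>2 \<le> (norm (Y x))\<^sup>2" using W0 by (intro power_mono) auto
    thus ?thesis using W0 by simp
  qed
  define \<psi> where "\<psi> n x = 1 - (1 - (of_real (sqrt (X n)) / (of_real (sqrt (X n)) + Y x))\<^sup>2)\<^sup>2" for n x
  have \<psi>_mult: "\<psi> n \<in> H1_multiplier" for n
    unfolding \<psi>_def using X
    by (intro H1_multiplier_diff H1_multiplier_const H1_multiplier_power \<phi>) auto
  have \<psi>1: "norm (\<psi> n x) * (norm (Y x))\<^sup>2 \<le> 3 * min (X n) ((norm (Y x))\<^sup>2)"
    and \<psi>2: "X n * norm (1 - \<psi> n x) \<le> 4 * min (X n) ((norm (Y x))\<^sup>2)" for n x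
    using resolvent_cutoff_bounds[of "sqrt (X n)" "Y x"] X[of n] W0[of x]
    by (simp_all add: ReY \<psi>_def)
  define h where "h n x = \<psi> n x * f n x" for n x
  have h_H1: "h n \<in> H1" for n unfolding h_def using \<psi>_mult f_H1 by (rule H1_multiplier_mult_H1)
  have [measurable]: "h n \<in> borel_measurable circ" for n using H1_measurable[OF h_H1] .
  have h_bound: "norm (h n x) \<le> 3 * X n / \<delta>" if "n < N" for n x
  proof (cases "f n x = 0")
    case True
    thus ?thesis using X[of n] \<delta> by (simp add: h_def)
  next
    case False
    have "norm (f n x) \<le> (\<Sum>n<N. norm (f n x))" using that by (intro member_le_sum) auto
    hence "\<delta> * norm (f n x) \<le> \<delta> * (\<Sum>n<N. norm (f n x))" using \<delta> by (intro mult_left_mono) auto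
    also have "\<dots> \<le> W x" using y by (simp add: W_def)
    also note WY
    finally have "norm (\<psi> n x) * (\<delta> * norm (f n x)) \<le> norm (\<psi> n x) * (norm (Y x))\<^sup>2"
      by (intro mult_left_mono) auto
    also have "\<dots> \<le> 3 * X n" using \<psi>1[of n x] by simp
    finally show ?thesis using \<delta> by (simp add: h_def norm_mult field_simps)
  qed
  let ?m = "\<lambda>n x. norm (f n x) * min (X n) ((norm (Y x))\<^sup>2)"
  have im: "integrable circ (?m n)" for n
  proof (rule Bochner_Integration.integrable_bound)
    show "integrable circ (\<lambda>x. X n * norm (f n x))" using f_integrable by auto
    have "?m n x \<le> norm (f n x) * X n" for x by (intro mult_left_mono) auto
    thus "AE x in circ. norm (?m n x) \<le> norm (X n * norm (f n x))"
      using X[of n] by (auto simp: abs_mult mult.commute intro!: always_eventually)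
  qed measurable
  have 1: "X n * (\<integral>x. norm (f n x - h n x) \<partial>circ) \<le> 4 * (\<integral>x. ?m n x \<partial>circ)" for n
  proof -
    have "X n * (\<integral>x. norm (f n x - h n x) \<partial>circ) = (\<integral>x. X n * norm (f n x - h n x) \<partial>circ)" by simp
    also have "\<dots> \<le> (\<integral>x. 4 * ?m n x \<partial>circ)"
    proof (rule Bochner_Integration.integral_mono')
      fix x
      have "X n * norm (f n x - h n x) = norm (f n x) * (X n * norm (1 - \<psi> n x))"
        by (simp add: h_def norm_mult flip: norm_mult) (simp add: algebra_simps flip: norm_mult)
      also have "\<dots> \<le> norm (f n x) * (4 * min (X n) ((norm (Y x))\<^sup>2))"
        by (intro mult_left_mono \<psi>2) auto
      finally show "X n * norm (f n x - h n x) \<le> 4 * ?m n x" by simp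
    qed (use im X in auto)
    finally show ?thesis using im by simp
  qed
  have iyh: "integrable circ (\<lambda>x. y x * norm (h n x))" if "n < N" for n
  proof (rule Bochner_Integration.integrable_bound)
    show "integrable circ (\<lambda>x. (3 * X n / \<delta>) * y x)" using y by auto
    have "y x * norm (h n x) \<le> y x * (3 * X n / \<delta>)" for x
      using h_bound[OF that] y by (intro mult_left_mono) auto
    thus "AE x in circ. norm (y x * norm (h n x)) \<le> norm ((3 * X n / \<delta>) * y x)"
      using y X[of n] \<delta>
      by (auto simp: abs_mult abs_divide mult.commute intro!: always_eventually)
  qed measurable
  have 2: "(\<integral>x. y x * norm (h n x) \<partial>circ) \<le> 3 * (\<integral>x. ?m n x \<partial>circ)" if "n < N" for n
  proof -
    have "(\<integral>x. y x * norm (h n x) \<partial>circ) \<le> (\<integral>x. 3 * ?m n x \<partial>circ)"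
    proof (rule Bochner_Integration.integral_mono')
      fix x
      have "y x \<le> W x" using \<delta> by (auto simp: W_def intro!: mult_nonneg_nonneg sum_nonneg)
      hence "y x \<le> (norm (Y x))\<^sup>2" using WY[of x] by simp
      hence "y x * norm (h n x) \<le> (norm (Y x))\<^sup>2 * norm (h n x)" by (intro mult_right_mono) auto
      also have "\<dots> = norm (f n x) * (norm (\<psi> n x) * (norm (Y x))\<^sup>2)" by (simp add: h_def norm_mult)
      also have "\<dots> \<le> norm (f n x) * (3 * min (X n) ((norm (Y x))\<^sup>2))"
        by (intro mult_left_mono \<psi>1) auto
      finally show "y x * norm (h n x) \<le> 3 * ?m n x" by simp
    qed (use im X in auto)
    thus ?thesis using im by simp
  qed
  have "(\<integral>x. y x * (\<Sum>n<N. norm (h n x)) \<partial>circ) = (\<Sum>n<N. \<integral>x. y x * norm (h n x) \<partial>circ)"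
    using iyh by (simp add: sum_distrib_left)
  also have "\<dots> \<le> (\<Sum>n<N. 3 * (\<integral>x. ?m n x \<partial>circ))" by (intro sum_mono 2) auto
  finally have "(\<Sum>n<N. X n * (\<integral>x. norm (f n x - h n x) \<partial>circ)) + (\<integral>x. y x * (\<Sum>n<N. norm (h n x)) \<partial>circ)
    \<le> (\<Sum>n<N. 4 * (\<integral>x. ?m n x \<partial>circ)) + (\<Sum>n<N. 3 * (\<integral>x. ?m n x \<partial>circ))"
    by (intro add_mono sum_mono 1)
  also have "\<dots> = 7 * (\<Sum>n<N. \<integral>x. ?m n x \<partial>circ)" by (simp add: sum_distrib_left flip: sum.distrib)
  also have "(\<Sum>n<N. \<integral>x. ?m n x \<partial>circ) \<le> (\<Sum>n<N. X n) + (\<integral>x. (norm (Y x))\<^sup>2 \<partial>circ) / t"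
    by (rule sum_integral_min_le[where a = "\<lambda>n x. norm (f n x)"])
       (use t_pos f_integrable sum_bound X Y2 in auto)
  also have "(\<integral>x. (norm (Y x))\<^sup>2 \<partial>circ) / t \<le> 4 * (\<integral>x. W x \<partial>circ) / t"
    using Yint W0 t_pos by (intro divide_right_mono) auto
  also have "(\<integral>x. W x \<partial>circ) = (\<integral>x. y x \<partial>circ) + \<delta> * (\<Sum>n<N. \<integral>x. norm (f n x) \<partial>circ)"
    unfolding W_def using y f_integrable by simp
  finally have main: "(\<Sum>n<N. X n * (\<integral>x. norm (f n x - h n x) \<partial>circ)) + (\<integral>x. y x * (\<Sum>n<N. norm (h n x)) \<partial>circ)
    \<le> 7 * ((\<Sum>n<N. X n) + 4 * ((\<integral>x. y x \<partial>circ) + \<delta> * (\<Sum>n<N. \<integral>x. norm (f n x) \<partial>circ)) / t)"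
    by simp
  have "(\<Sum>n<N. X n) \<ge> 0" using X by (intro sum_nonneg) auto
  hence "7 * ((\<Sum>n<N. X n) + 4 * ((\<integral>x. y x \<partial>circ) + \<delta> * (\<Sum>n<N. \<integral>x. norm (f n x) \<partial>circ)) / t)
    \<le> 28 * ((\<Sum>n<N. X n) + (\<integral>x. y x \<partial>circ) / t + \<delta> * (\<Sum>n<N. \<integral>x. norm (f n x) \<partial>circ) / t)"
    by (simp add: algebra_simps add_divide_distrib)
  thus ?thesis using that[of h] h_H1 h_bound main by force
qed

subsection \<open>Near-minimisers of the penalty\<close>

text \<open>The right side of \<open>sum_bound\<close> for one index and the whole circle.\<close>

definition mass_bound :: real where
  "mass_bound = max 1 (1 / t)"

lemma f_norm_le: "(\<integral>x. norm (f n x) \<partial>circ) \<le> mass_bound"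
proof -
  have "(\<integral>x\<in>{0..1}. norm (f n x) \<partial>circ) \<le> mass_bound"
    using sum_bound[of "{n}" "{0..1}"] sets.top[of circ] by (simp add: mass_bound_def)
  moreover have "(\<integral>x\<in>{0..1}. norm (f n x) \<partial>circ) = (\<integral>x. norm (f n x) \<partial>circ)"
    unfolding set_lebesgue_integral_def by (intro Bochner_Integration.integral_cong) auto
  ultimately show ?thesis by simp
qed

definition dev :: "(nat \<Rightarrow> real \<Rightarrow> complex) \<Rightarrow> nat \<Rightarrow> real" where
  "dev h n = (\<integral>x. norm (f n x - h n x) \<partial>circ)"

text \<open>The factor \<open>t\<close> rescales the desired bound C / t to the threshold that
  applies to \<open>dev\<close>.\<close>

definition height :: "nat \<Rightarrow> (nat \<Rightarrow> real \<Rightarrow> complex) \<Rightarrow> real \<Rightarrow> real" where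
  "height N h x = t * (\<Sum>n<N. norm (h n x))"

text \<open>The factors \<open>(1 / 2) ^ n\<close> keep the penalty of the zero family bounded
  independently of \<open>N\<close>. The division by \<open>t\<close> matches the way
  \<open>y\<close> enters the right side of \<open>weighted_decomposition\<close>.\<close>

definition penalty :: "nat \<Rightarrow> (nat \<Rightarrow> real \<Rightarrow> complex) \<Rightarrow> real" where
  "penalty N h = (\<Sum>n<N. (1 / 2) ^ n * (excess (dev h n))\<^sup>2) + (\<integral>x. (excess (height N h x))\<^sup>2 \<partial>circ) / t"

text \<open>The sum of the \<open>X n\<close> plus the integral of \<open>y\<close> over t, for the
  weights that the derivative of the penalty supplies to
  \<open>weighted_decomposition\<close>.\<close>

definition total_excess :: "nat \<Rightarrow> (nat \<Rightarrow> real \<Rightarrow> complex) \<Rightarrow> real" where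
  "total_excess N h = (\<Sum>n<N. (1 / 2) ^ n * excess (dev h n)) + (\<integral>x. excess (height N h x) \<partial>circ) / t"

text \<open>The bound \<open>M\<close> keeps the quadratic remainder of a convex step finite. It
  will depend on \<open>N\<close> and on the accuracy, so it is lost in the limit, where the L^2
  bound takes over.\<close>

definition bounded_family :: "nat \<Rightarrow> real \<Rightarrow> (nat \<Rightarrow> real \<Rightarrow> complex) set" where
  "bounded_family N M = {h. (\<forall>n. h n \<in> H1) \<and> (\<forall>n x. norm (h n x) \<le> M) \<and> (\<forall>n\<ge>N. \<forall>x. h n x = 0)}"

lemma height_nonneg: "0 \<le> height N h x"
  using t_pos by (auto simp: height_def intro!: mult_nonneg_nonneg sum_nonneg)

lemma height_le:
  assumes "h \<in> bounded_family N M"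
  shows "height N h x \<le> t * N * M"
proof -
  have "(\<Sum>n<N. norm (h n x)) \<le> (\<Sum>n<N. M)"
    using assms by (intro sum_mono) (auto simp: bounded_family_def)
  thus ?thesis using t_pos by (simp add: height_def mult.assoc)
qed

lemma height_measurable:
  assumes "\<And>n. h n \<in> H1"
  shows "height N h \<in> borel_measurable circ"
proof -
  have [measurable]: "h n \<in> borel_measurable circ" for n using assms H1_measurable by blast
  show ?thesis unfolding height_def by measurable
qed

lemma dev_nonneg: "0 \<le> dev h n"
  by (simp add: dev_def)

lemma dev_le:
  assumes "h \<in> bounded_family N M"
  shows "dev h n \<le> mass_bound + M"
proof -
  have h: "h n \<in> H1" "\<And>x. norm (h n x) \<le> M" using assms by (auto simp: bounded_family_def)
  have "dev h n \<le> (\<integral>x. norm (f n x) + M \<partial>circ)"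
    unfolding dev_def
  proof (rule Bochner_Integration.integral_mono)
    show "norm (f n x - h n x) \<le> norm (f n x) + M" for x
      using norm_triangle_ineq4[of "f n x" "h n x"] h(2)[of x] by simp
  qed (use f_integrable H1_integrable[OF h(1)] in auto)
  also have "\<dots> = (\<integral>x. norm (f n x) \<partial>circ) + M" using f_integrable by simp
  finally show ?thesis using f_norm_le[of n] by simp
qed

lemma integrable_excess_height:
  assumes "h \<in> bounded_family N M"
  shows "integrable circ (\<lambda>x. excess (height N h x))" "integrable circ (\<lambda>x. (excess (height N h x))\<^sup>2)"
proof -
  have [measurable]: "height N h \<in> borel_measurable circ"
    using assms by (intro height_measurable) (auto simp: bounded_family_def)
  have le: "excess (height N h x) \<le> t * N * M" for x
    using height_le[OF assms, of x] excess_le[OF height_nonneg] order_trans by blast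
  show "integrable circ (\<lambda>x. excess (height N h x))"
    by (rule integrable_circ_bounded[where B = "t * N * M"]) (use le in auto)
  show "integrable circ (\<lambda>x. (excess (height N h x))\<^sup>2)"
    by (rule integrable_circ_bounded[where B = "(t * N * M)\<^sup>2"])
       (use power_mono[OF le, where n = 2] in auto)
qed

lemma penalty_nonneg: "0 \<le> penalty N h"
  using t_pos unfolding penalty_def
  by (intro add_nonneg_nonneg sum_nonneg divide_nonneg_pos Bochner_Integration.integral_nonneg) auto

lemma mass_bound_ge_1: "1 \<le> mass_bound"
  by (simp add: mass_bound_def)

text \<open>The added 1 leaves room for a near-minimiser in place of a minimiser.\<close>

definition penalty_bound :: real where
  "penalty_bound = 2 * mass_bound\<^sup>2 + 1"

lemma penalty_zero_le: "penalty N (\<lambda>n x. 0) \<le> 2 * mass_bound\<^sup>2"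
proof -
  have "penalty N (\<lambda>n x. 0) = (\<Sum>n<N. (1 / 2) ^ n * (excess (dev (\<lambda>n x. 0) n))\<^sup>2)"
    by (simp add: penalty_def height_def excess_def)
  also have "\<dots> \<le> (\<Sum>n<N. (1 / 2) ^ n * mass_bound\<^sup>2)"
  proof (intro sum_mono mult_left_mono power_mono)
    fix n
    have "excess (dev (\<lambda>n x. 0) n) \<le> dev (\<lambda>n x. 0) n" by (intro excess_le dev_nonneg)
    also have "\<dots> \<le> mass_bound" using f_norm_le by (simp add: dev_def)
    finally show "excess (dev (\<lambda>n x. 0) n) \<le> mass_bound" .
  qed auto
  also have "\<dots> = (\<Sum>n<N. (1 / 2) ^ n) * mass_bound\<^sup>2" by (simp add: sum_distrib_right)
  also have "(\<Sum>n<N. (1 / 2 :: real) ^ n) \<le> 2"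
    by (simp add: sum_gp_strict)
  finally show ?thesis by (simp add: mult_right_mono)
qed

text \<open>The linear term is the derivative of the penalty, read off from
  \<open>excess_sq_convex_step\<close>: the excesses of \<open>h\<close> become weights on the
  deviations and moduli of the competitor \<open>h'\<close>. In the integral the factor
  \<open>t\<close> inside \<open>height\<close> cancels the division by \<open>t\<close>.\<close>

lemma penalty_convex_step:
  assumes h: "h \<in> bounded_family N M" and h': "h' \<in> bounded_family N M" and \<epsilon>: "0 \<le> \<epsilon>" "\<epsilon> \<le> 1"
  defines "k \<equiv> \<lambda>n x. of_real (1 - \<epsilon>) * h n x + of_real \<epsilon> * h' n x"
  shows "k \<in> bounded_family N M"
    and "penalty N k \<le> penalty N h
      + 2 * \<epsilon> * ((\<Sum>n<N. (1 / 2) ^ n * excess (dev h n) * dev h' n)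
          + (\<integral>x. excess (height N h x) * (\<Sum>n<N. norm (h' n x)) \<partial>circ) - 29 * total_excess N h)
      + \<epsilon>\<^sup>2 * (N * (mass_bound + M)\<^sup>2 + (t * N * M)\<^sup>2 / t)"
proof -
  have H: "h n \<in> H1" "h' n \<in> H1" "norm (h n x) \<le> M" "norm (h' n x) \<le> M" for n x
    using h h' by (auto simp: bounded_family_def)
  have M0: "0 \<le> M" using H(3) norm_ge_zero order_trans by blast
  have nk: "norm (k n x) \<le> (1 - \<epsilon>) * norm (h n x) + \<epsilon> * norm (h' n x)" for n x
    using norm_triangle_ineq[of "of_real (1 - \<epsilon>) * h n x" "of_real \<epsilon> * h' n x"] \<epsilon>
    by (simp add: k_def norm_mult del: of_real_diff)
  have "norm (k n x) \<le> M" for n x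
  proof -
    note nk[of n x]
    also have "(1 - \<epsilon>) * norm (h n x) + \<epsilon> * norm (h' n x) \<le> (1 - \<epsilon>) * M + \<epsilon> * M"
      using \<epsilon> H by (intro add_mono mult_left_mono) auto
    finally show ?thesis by (simp add: algebra_simps)
  qed
  moreover have "k n \<in> H1" for n unfolding k_def by (intro H1_add H1_cmult H)
  ultimately show k: "k \<in> bounded_family N M"
    using h h' by (auto simp: bounded_family_def k_def)
  have int: "integrable circ (\<lambda>x. norm (f n x - h n x))" "integrable circ (\<lambda>x. norm (f n x - h' n x))"
    "integrable circ (\<lambda>x. norm (f n x - k n x))" for n
    using f_integrable H1_integrable[OF H(1)] H1_integrable[OF H(2)] k
    by (auto simp: bounded_family_def H1_integrable)
  have dev_k: "dev k n \<le> (1 - \<epsilon>) * dev h n + \<epsilon> * dev h' n" for n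
  proof -
    have "dev k n \<le> (\<integral>x. (1 - \<epsilon>) * norm (f n x - h n x) + \<epsilon> * norm (f n x - h' n x) \<partial>circ)"
      unfolding dev_def
    proof (rule Bochner_Integration.integral_mono)
      fix x
      have "f n x - k n x = of_real (1 - \<epsilon>) * (f n x - h n x) + of_real \<epsilon> * (f n x - h' n x)"
        by (simp add: k_def algebra_simps)
      also have "norm \<dots> \<le> (1 - \<epsilon>) * norm (f n x - h n x) + \<epsilon> * norm (f n x - h' n x)"
        using norm_triangle_ineq[of "of_real (1 - \<epsilon>) * (f n x - h n x)" "of_real \<epsilon> * (f n x - h' n x)"] \<epsilon>
        by (simp add: norm_mult del: of_real_diff)
      finally show "norm (f n x - k n x) \<le> (1 - \<epsilon>) * norm (f n x - h n x) + \<epsilon> * norm (f n x - h' n x)" .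
    qed (use int in auto)
    thus ?thesis using int by (simp add: dev_def)
  qed
  have height_k: "height N k x \<le> (1 - \<epsilon>) * height N h x + \<epsilon> * height N h' x" for x
  proof -
    have "(\<Sum>n<N. norm (k n x)) \<le> (\<Sum>n<N. (1 - \<epsilon>) * norm (h n x) + \<epsilon> * norm (h' n x))"
      by (intro sum_mono nk)
    hence "height N k x \<le> t * (\<Sum>n<N. (1 - \<epsilon>) * norm (h n x) + \<epsilon> * norm (h' n x))"
      unfolding height_def using t_pos by simp
    also have "\<dots> = (1 - \<epsilon>) * height N h x + \<epsilon> * height N h' x"
      unfolding height_def sum.distrib sum_distrib_left[symmetric] by (simp add: algebra_simps)
    finally show ?thesis .
  qed
  have "(\<Sum>n<N. (1 / 2) ^ n * (excess (dev k n))\<^sup>2) \<le>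
    (\<Sum>n<N. (1 / 2) ^ n * (excess (dev h n))\<^sup>2
      + 2 * \<epsilon> * ((1 / 2) ^ n * excess (dev h n) * dev h' n - 29 * ((1 / 2) ^ n * excess (dev h n)))
      + \<epsilon>\<^sup>2 * (mass_bound + M)\<^sup>2)"
  proof (rule sum_mono)
    fix n
    have "(excess (dev k n))\<^sup>2 \<le> (excess (dev h n))\<^sup>2
        + 2 * \<epsilon> * (excess (dev h n) * dev h' n - 29 * excess (dev h n)) + \<epsilon>\<^sup>2 * (dev h' n - dev h n)\<^sup>2"
      by (intro excess_sq_convex_step \<epsilon> dev_k)
    hence "(1 / 2) ^ n * (excess (dev k n))\<^sup>2 \<le> (1 / 2) ^ n * ((excess (dev h n))\<^sup>2
        + 2 * \<epsilon> * (excess (dev h n) * dev h' n - 29 * excess (dev h n)) + \<epsilon>\<^sup>2 * (dev h' n - dev h n)\<^sup>2)"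
      by (intro mult_left_mono) auto
    also have "\<dots> = (1 / 2) ^ n * (excess (dev h n))\<^sup>2
      + 2 * \<epsilon> * ((1 / 2) ^ n * excess (dev h n) * dev h' n - 29 * ((1 / 2) ^ n * excess (dev h n)))
      + \<epsilon>\<^sup>2 * ((1 / 2) ^ n * (dev h' n - dev h n)\<^sup>2)"
      by (simp add: algebra_simps)
    also have "(1 / 2) ^ n * (dev h' n - dev h n)\<^sup>2 \<le> 1 * (mass_bound + M)\<^sup>2"
    proof (intro mult_mono)
      have "\<bar>dev h' n - dev h n\<bar> \<le> mass_bound + M"
        using dev_le[OF h, of n] dev_le[OF h', of n] dev_nonneg[of h n] dev_nonneg[of h' n] by linarith
      hence "\<bar>dev h' n - dev h n\<bar>\<^sup>2 \<le> (mass_bound + M)\<^sup>2" by (intro power_mono) auto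
      thus "(dev h' n - dev h n)\<^sup>2 \<le> (mass_bound + M)\<^sup>2" by simp
    qed (auto intro: power_le_one)
    finally show "(1 / 2) ^ n * (excess (dev k n))\<^sup>2 \<le> (1 / 2) ^ n * (excess (dev h n))\<^sup>2
      + 2 * \<epsilon> * ((1 / 2) ^ n * excess (dev h n) * dev h' n - 29 * ((1 / 2) ^ n * excess (dev h n)))
      + \<epsilon>\<^sup>2 * (mass_bound + M)\<^sup>2"
      by (simp add: mult_left_mono)
  qed
  also have "\<dots> = (\<Sum>n<N. (1 / 2) ^ n * (excess (dev h n))\<^sup>2)
      + 2 * \<epsilon> * ((\<Sum>n<N. (1 / 2) ^ n * excess (dev h n) * dev h' n)
          - 29 * (\<Sum>n<N. (1 / 2) ^ n * excess (dev h n)))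
      + \<epsilon>\<^sup>2 * (N * (mass_bound + M)\<^sup>2)"
    by (simp add: sum.distrib sum_subtractf flip: sum_distrib_left)
  finally have sum_part: "(\<Sum>n<N. (1 / 2) ^ n * (excess (dev k n))\<^sup>2) \<le> \<dots>" .
  note iE = integrable_excess_height[OF h] integrable_excess_height[OF k]
  have [measurable]: "height N h \<in> borel_measurable circ" "height N h' \<in> borel_measurable circ"
    by (intro height_measurable H)+
  have iEh': "integrable circ (\<lambda>x. excess (height N h x) * height N h' x)"
  proof (rule Bochner_Integration.integrable_bound)
    show "integrable circ (\<lambda>x. (t * N * M) * excess (height N h x))" using iE by auto
    have "excess (height N h x) * height N h' x \<le> excess (height N h x) * (t * N * M)" for x
      by (intro mult_left_mono height_le[OF h']) auto
    thus "AE x in circ. norm (excess (height N h x) * height N h' x) \<le> norm ((t * N * M) * excess (height N h x))"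
      using height_nonneg[of N h'] t_pos M0 by (auto simp: abs_mult mult.commute intro!: always_eventually)
  qed measurable
  have "(\<integral>x. (excess (height N k x))\<^sup>2 \<partial>circ) \<le> (\<integral>x. (excess (height N h x))\<^sup>2
      + 2 * \<epsilon> * (excess (height N h x) * height N h' x - 29 * excess (height N h x)) + \<epsilon>\<^sup>2 * (t * N * M)\<^sup>2 \<partial>circ)"
  proof (rule Bochner_Integration.integral_mono)
    fix x
    have "\<bar>height N h' x - height N h x\<bar> \<le> t * N * M"
      using height_le[OF h, of x] height_le[OF h', of x] height_nonneg[of N h x] height_nonneg[of N h' x]
      by linarith
    hence "\<bar>height N h' x - height N h x\<bar>\<^sup>2 \<le> (t * N * M)\<^sup>2" by (intro power_mono) auto
    hence "\<epsilon>\<^sup>2 * (height N h' x - height N h x)\<^sup>2 \<le> \<epsilon>\<^sup>2 * (t * N * M)\<^sup>2"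
      by (intro mult_left_mono) auto
    moreover have "(excess (height N k x))\<^sup>2 \<le> (excess (height N h x))\<^sup>2
        + 2 * \<epsilon> * (excess (height N h x) * height N h' x - 29 * excess (height N h x))
        + \<epsilon>\<^sup>2 * (height N h' x - height N h x)\<^sup>2"
      by (intro excess_sq_convex_step \<epsilon> height_k)
    ultimately show "(excess (height N k x))\<^sup>2 \<le> (excess (height N h x))\<^sup>2
      + 2 * \<epsilon> * (excess (height N h x) * height N h' x - 29 * excess (height N h x)) + \<epsilon>\<^sup>2 * (t * N * M)\<^sup>2"
      by linarith
  qed (use iE iEh' in auto)
  also have "\<dots> = (\<integral>x. (excess (height N h x))\<^sup>2 \<partial>circ)
      + 2 * \<epsilon> * ((\<integral>x. excess (height N h x) * height N h' x \<partial>circ) - 29 * (\<integral>x. excess (height N h x) \<partial>circ))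
      + \<epsilon>\<^sup>2 * (t * N * M)\<^sup>2"
    using iE iEh' by simp
  also have "(\<integral>x. excess (height N h x) * height N h' x \<partial>circ) =
      t * (\<integral>x. excess (height N h x) * (\<Sum>n<N. norm (h' n x)) \<partial>circ)"
    by (simp add: height_def[of N h'] mult.left_commute[of _ t])
  finally have "(\<integral>x. (excess (height N k x))\<^sup>2 \<partial>circ) / t \<le> ((\<integral>x. (excess (height N h x))\<^sup>2 \<partial>circ)
      + 2 * \<epsilon> * (t * (\<integral>x. excess (height N h x) * (\<Sum>n<N. norm (h' n x)) \<partial>circ) - 29 * (\<integral>x. excess (height N h x) \<partial>circ))
      + \<epsilon>\<^sup>2 * (t * N * M)\<^sup>2) / t"
    using t_pos by (intro divide_right_mono) auto
  also have "\<dots> = (\<integral>x. (excess (height N h x))\<^sup>2 \<partial>circ) / t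
      + 2 * \<epsilon> * ((\<integral>x. excess (height N h x) * (\<Sum>n<N. norm (h' n x)) \<partial>circ) - 29 * ((\<integral>x. excess (height N h x) \<partial>circ) / t))
      + \<epsilon>\<^sup>2 * ((t * N * M)\<^sup>2 / t)"
    using t_pos by (simp add: add_divide_distrib diff_divide_distrib right_diff_distrib)
  finally have int_part: "(\<integral>x. (excess (height N k x))\<^sup>2 \<partial>circ) / t \<le> \<dots>" .
  show "penalty N k \<le> penalty N h
      + 2 * \<epsilon> * ((\<Sum>n<N. (1 / 2) ^ n * excess (dev h n) * dev h' n)
          + (\<integral>x. excess (height N h x) * (\<Sum>n<N. norm (h' n x)) \<partial>circ) - 29 * total_excess N h)
      + \<epsilon>\<^sup>2 * (N * (mass_bound + M)\<^sup>2 + (t * N * M)\<^sup>2 / t)"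
    using add_mono[OF sum_part int_part] unfolding penalty_def total_excess_def
    by (simp add: distrib_left right_diff_distrib)
qed

text \<open>At a near-minimiser of the penalty, its derivative supplies the weights for
  \<open>weighted_decomposition\<close>; moving towards the resulting family would lower the penalty
  at rate \<open>29 - 28\<close> times the total excess.\<close>

lemma exists_small_excess:
  assumes \<eta>: "\<eta> > 0"
  obtains h M where "h \<in> bounded_family N M" "total_excess N h \<le> \<eta>" "penalty N h \<le> penalty_bound"
proof -
  \<comment> \<open>56 = 2 * 28, so the error term of \<open>weighted_decomposition\<close> costs at
    most \<eta> / 2. The added 1 keeps the denominator positive for \<open>N = 0\<close>.\<close>
  define \<delta> where "\<delta> = \<eta> * t / (56 * (N * mass_bound + 1))"
  have mb: "mass_bound > 0" using mass_bound_ge_1 by simp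
  hence Nm: "N * mass_bound + 1 > 0" by (simp add: add_nonneg_pos)
  hence \<delta>: "\<delta> > 0" using \<eta> t_pos by (simp add: \<delta>_def)
  have pb: "penalty_bound \<ge> 0" by (simp add: penalty_bound_def)
  \<comment> \<open>Fixed before \<open>h\<close> is chosen: every weight will be at most
    \<open>sqrt penalty_bound\<close>, so this is the pointwise bound that
    \<open>weighted_decomposition\<close> gives for the competitor.\<close>
  define M where "M = 3 * sqrt penalty_bound / \<delta>"
  have M0: "M \<ge> 0" using \<delta> pb by (simp add: M_def)
  define B where "B = N * (mass_bound + M)\<^sup>2 + (t * N * M)\<^sup>2 / t"
  have B0: "B \<ge> 0" using t_pos by (simp add: B_def)
  \<comment> \<open>Both the step length and the square root of the tolerance for near-minimality:
    the final inequality can then be divided by \<epsilon>, which leaves a remainder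
    \<open>\<epsilon> * (1 + B)\<close> of at most \<eta>.\<close>
  define \<epsilon> where "\<epsilon> = min 1 (\<eta> / (1 + B))"
  have \<epsilon>: "\<epsilon> > 0" "\<epsilon> \<le> 1" using \<eta> B0 by (auto simp: \<epsilon>_def)
  have "\<epsilon> * (1 + B) \<le> \<eta> / (1 + B) * (1 + B)" using B0 by (intro mult_right_mono) (auto simp: \<epsilon>_def)
  hence \<epsilon>B: "\<epsilon> * (1 + B) \<le> \<eta>" using B0 by simp
  define J where "J = Inf (penalty N ` bounded_family N M)"
  have "(\<lambda>x. 0) \<in> H1" by (simp add: H1_def fourier_coeff_def)
  hence zero: "(\<lambda>n x. 0) \<in> bounded_family N M" using M0 by (auto simp: bounded_family_def)
  have bdd: "bdd_below (penalty N ` bounded_family N M)"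
    using penalty_nonneg by (intro bdd_belowI[of _ 0]) auto
  have J_le: "J \<le> penalty N k" if "k \<in> bounded_family N M" for k
    unfolding J_def using bdd that by (intro cInf_lower) auto
  have "Inf (penalty N ` bounded_family N M) < J + \<epsilon>\<^sup>2" using \<epsilon> by (simp add: J_def)
  then obtain h where h: "h \<in> bounded_family N M" "penalty N h < J + \<epsilon>\<^sup>2"
    using cInf_lessD[of "penalty N ` bounded_family N M"] zero by blast
  have "\<epsilon>\<^sup>2 \<le> 1" using \<epsilon> by (simp add: power_le_one)
  hence hb: "penalty N h \<le> penalty_bound"
    using h(2) J_le[OF zero] penalty_zero_le[of N] by (simp add: penalty_bound_def)
  define X where "X n = (1 / 2) ^ n * excess (dev h n)" for n
  define y where "y x = excess (height N h x)" for x
  have y_eq: "y = (\<lambda>x. excess (height N h x))" by (simp add: fun_eq_iff y_def)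
  have X0: "X n \<ge> 0" for n by (simp add: X_def)
  have Xle: "X n \<le> sqrt penalty_bound" if "n < N" for n
  proof (rule real_le_rsqrt)
    \<comment> \<open>One factor \<open>(1 / 2) ^ n\<close> belongs to the penalty; the other is at
      most 1.\<close>
    have "(X n)\<^sup>2 = (1 / 2) ^ n * ((1 / 2) ^ n * (excess (dev h n))\<^sup>2)"
      by (simp add: X_def power2_eq_square)
    also have "\<dots> \<le> 1 * ((1 / 2) ^ n * (excess (dev h n))\<^sup>2)"
      by (intro mult_right_mono) (auto intro: power_le_one)
    also have "\<dots> \<le> (\<Sum>n<N. (1 / 2) ^ n * (excess (dev h n))\<^sup>2)"
      using that by (simp, intro member_le_sum) auto
    also have "\<dots> \<le> penalty N h" using t_pos by (simp add: penalty_def)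
    also note hb
    finally show "(X n)\<^sup>2 \<le> penalty_bound" .
  qed
  have yi: "integrable circ y" unfolding y_def by (rule integrable_excess_height[OF h(1)])
  have y0: "y x \<ge> 0" for x by (simp add: y_def)
  obtain h0 where h0: "\<And>n. h0 n \<in> H1" "\<And>n x. n < N \<Longrightarrow> norm (h0 n x) \<le> 3 * X n / \<delta>"
    "(\<Sum>n<N. X n * (\<integral>x. norm (f n x - h0 n x) \<partial>circ)) + (\<integral>x. y x * (\<Sum>n<N. norm (h0 n x)) \<partial>circ)
      \<le> 28 * ((\<Sum>n<N. X n) + (\<integral>x. y x \<partial>circ) / t + \<delta> * (\<Sum>n<N. \<integral>x. norm (f n x) \<partial>circ) / t)"
    using weighted_decomposition[of X y \<delta> N, OF X0 yi y0 \<delta>] by blast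
  define h' where "h' n = (if n < N then h0 n else (\<lambda>x. 0))" for n
  have h': "h' \<in> bounded_family N M"
  proof -
    have "norm (h' n x) \<le> M" for n x
    proof (cases "n < N")
      case True
      have "3 * X n / \<delta> \<le> M" unfolding M_def using Xle[OF True] \<delta> by (intro divide_right_mono) auto
      thus ?thesis using h0(2)[OF True, of x] True by (simp add: h'_def)
    qed (use M0 in \<open>simp add: h'_def\<close>)
    thus ?thesis using h0(1) \<open>(\<lambda>x. 0) \<in> H1\<close> by (auto simp: bounded_family_def h'_def)
  qed
  define D where "D = \<delta> * (\<Sum>n<N. \<integral>x. norm (f n x) \<partial>circ) / t"
  have D: "28 * D \<le> \<eta> / 2"
  proof -
    have "(\<Sum>n<N. \<integral>x. norm (f n x) \<partial>circ) \<le> (\<Sum>n<N. mass_bound)" by (intro sum_mono f_norm_le)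
    hence "28 * D \<le> 28 * (\<delta> * (N * mass_bound + 1) / t)"
      unfolding D_def using \<delta> t_pos by (intro mult_left_mono divide_right_mono) auto
    also have "\<dots> = \<eta> / 2"
    proof -
      define G where "G = N * mass_bound + 1"
      have "G > 0" using Nm by (simp add: G_def)
      thus ?thesis using t_pos unfolding \<delta>_def G_def[symmetric] by simp
    qed
    finally show ?thesis .
  qed
  have S: "total_excess N h = (\<Sum>n<N. X n) + (\<integral>x. y x \<partial>circ) / t"
    by (simp add: total_excess_def X_def y_def)
  have step: "(\<Sum>n<N. (1 / 2) ^ n * excess (dev h n) * dev h' n)
          + (\<integral>x. excess (height N h x) * (\<Sum>n<N. norm (h' n x)) \<partial>circ) \<le> 28 * (total_excess N h + D)"
    using h0(3) unfolding S D_def by (simp add: X_def y_eq dev_def h'_def)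
  define k where "k = (\<lambda>n x. of_real (1 - \<epsilon>) * h n x + of_real \<epsilon> * h' n x)"
  have k: "k \<in> bounded_family N M"
    unfolding k_def using \<epsilon> by (intro penalty_convex_step(1) h h') auto
  have "J \<le> penalty N k" by (rule J_le[OF k])
  also have "\<dots> \<le> penalty N h
      + 2 * \<epsilon> * ((\<Sum>n<N. (1 / 2) ^ n * excess (dev h n) * dev h' n)
          + (\<integral>x. excess (height N h x) * (\<Sum>n<N. norm (h' n x)) \<partial>circ) - 29 * total_excess N h)
      + \<epsilon>\<^sup>2 * B"
    unfolding k_def B_def using \<epsilon> by (intro penalty_convex_step(2) h h') auto
  also have "\<dots> \<le> penalty N h + 2 * \<epsilon> * (28 * (total_excess N h + D) - 29 * total_excess N h) + \<epsilon>\<^sup>2 * B"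
    using step \<epsilon> by (intro add_mono mult_left_mono diff_mono) auto
  \<comment> \<open>Near-minimality cancels \<open>penalty N h\<close> up to
    \<open>\<epsilon>\<^sup>2\<close>, and 28 - 29 leaves the total excess with coefficient
    -1.\<close>
  finally have "0 \<le> \<epsilon>\<^sup>2 + 2 * \<epsilon> * (28 * D - total_excess N h) + \<epsilon>\<^sup>2 * B"
    using h(2) by (simp add: algebra_simps)
  also have "\<dots> = \<epsilon> * (\<epsilon> * (1 + B) + 2 * (28 * D - total_excess N h))"
    by (simp add: algebra_simps power2_eq_square)
  finally have "0 \<le> \<epsilon> * (1 + B) + 2 * (28 * D - total_excess N h)"
    using \<epsilon> by (simp add: zero_le_mult_iff)
  hence "total_excess N h \<le> \<eta>" using D \<epsilon>B by argo
  thus ?thesis using that h(1) hb by blast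
qed

section \<open>Passage to the limit by Hilbert space projection\<close>

text \<open>Obtained by squaring and integrating
  \<open>t * norm (h n x) \<le> 29 + excess (height N h x)\<close>; it is free of \<open>N\<close>
  and \<open>M\<close>.\<close>

definition L2_bound :: real where
  "L2_bound = (2 * 29\<^sup>2 + 2 * t * penalty_bound) / t\<^sup>2"

lemma L2_bound_of_penalty:
  assumes h: "h \<in> bounded_family N M" and p: "penalty N h \<le> penalty_bound"
  shows "integrable circ (\<lambda>x. (norm (h n x))\<^sup>2)" "(\<integral>x. (norm (h n x))\<^sup>2 \<partial>circ) \<le> L2_bound"
proof -
  have H: "h n \<in> H1" "\<And>x. norm (h n x) \<le> M" using h by (auto simp: bounded_family_def)
  have [measurable]: "h n \<in> borel_measurable circ" using H1_measurable H by blast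
  show i: "integrable circ (\<lambda>x. (norm (h n x))\<^sup>2)"
    by (rule integrable_circ_bounded[where B = "M\<^sup>2"]) (use power_mono[OF H(2), where n = 2] in auto)
  note iE = integrable_excess_height(2)[OF h]
  have "t\<^sup>2 * (norm (h n x))\<^sup>2 \<le> 2 * 29\<^sup>2 + 2 * (excess (height N h x))\<^sup>2" for x
  proof -
    have "t * norm (h n x) \<le> height N h x"
    proof (cases "n < N")
      case True
      thus ?thesis unfolding height_def using t_pos by (intro mult_left_mono member_le_sum) auto
    next
      case False
      thus ?thesis using h height_nonneg[of N h x] by (auto simp: bounded_family_def)
    qed
    also have "\<dots> \<le> 29 + excess (height N h x)" by (simp add: excess_def)
    finally have "(t * norm (h n x))\<^sup>2 \<le> (29 + excess (height N h x))\<^sup>2"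
      using t_pos by (intro power_mono) auto
    also have "\<dots> \<le> 2 * 29\<^sup>2 + 2 * (excess (height N h x))\<^sup>2"
      using zero_le_power2[of "29 - excess (height N h x)"] by (simp add: power2_eq_square algebra_simps)
    finally show ?thesis by (simp add: power_mult_distrib)
  qed
  hence "(\<integral>x. t\<^sup>2 * (norm (h n x))\<^sup>2 \<partial>circ) \<le> (\<integral>x. 2 * 29\<^sup>2 + 2 * (excess (height N h x))\<^sup>2 \<partial>circ)"
    using i iE by (intro Bochner_Integration.integral_mono) auto
  also have "\<dots> = 2 * 29\<^sup>2 + 2 * (\<integral>x. (excess (height N h x))\<^sup>2 \<partial>circ)" using iE by simp
  also have "(\<integral>x. (excess (height N h x))\<^sup>2 \<partial>circ) / t \<le> penalty N h"
    by (simp add: penalty_def sum_nonneg)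
  hence "(\<integral>x. (excess (height N h x))\<^sup>2 \<partial>circ) \<le> t * penalty_bound"
    using p t_pos by (simp add: field_simps) (smt (verit) mult_left_mono mult.commute)
  finally show "(\<integral>x. (norm (h n x))\<^sup>2 \<partial>circ) \<le> L2_bound"
    using t_pos by (simp add: L2_bound_def field_simps)
qed

text \<open>\<open>k\<close> is both the number of constrained functions and the accuracy, which
  makes these convex sets decrease; the L^2 bound is the same for all \<open>k\<close>. A family in
  all of them meets the exact constraints.\<close>

definition near_solutions :: "nat \<Rightarrow> (nat \<Rightarrow> real \<Rightarrow> complex) set" where
  "near_solutions k = {h. (\<forall>n. h n \<in> H1 \<and> integrable circ (\<lambda>x. (norm (h n x))\<^sup>2) \<and>
        (\<integral>x. (norm (h n x))\<^sup>2 \<partial>circ) \<le> L2_bound) \<and>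
     (\<forall>n<k. dev h n \<le> 29 + 1 / Suc k) \<and> (\<integral>x. excess (height k h x) \<partial>circ) \<le> 1 / Suc k}"

lemma near_solutionsD:
  assumes "h \<in> near_solutions k"
  shows "h n \<in> H1" "integrable circ (\<lambda>x. (norm (h n x))\<^sup>2)" "(\<integral>x. (norm (h n x))\<^sup>2 \<partial>circ) \<le> L2_bound"
    "n < k \<Longrightarrow> dev h n \<le> 29 + 1 / Suc k" "(\<integral>x. excess (height k h x) \<partial>circ) \<le> 1 / Suc k"
  using assms by (auto simp: near_solutions_def)

lemma near_solutions_nonempty: "near_solutions k \<noteq> {}"
proof -
  \<comment> \<open>\<open>(1 / 2) ^ k\<close> offsets the weights of the indices below
    \<open>k\<close>, and \<open>min 1 (1 / t)\<close> the division by \<open>t\<close>.\<close>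
  define \<eta> where "\<eta> = (1 / 2) ^ k * min 1 (1 / t) / Suc k"
  have \<eta>: "\<eta> > 0" using t_pos by (simp add: \<eta>_def)
  obtain h M where h: "h \<in> bounded_family k M" "total_excess k h \<le> \<eta>" "penalty k h \<le> penalty_bound"
    using exists_small_excess[OF \<eta>] by blast
  have \<eta>1: "\<eta> \<le> (1 / 2) ^ k * (1 / Suc k)"
    unfolding \<eta>_def using mult_left_mono[of "min 1 (1 / t)" 1 "(1 / 2) ^ k"]
    by (simp add: divide_right_mono)
  have \<eta>2: "\<eta> \<le> 1 / t * (1 / Suc k)"
  proof -
    have "(1 / 2) ^ k * min 1 (1 / t) \<le> 1 * (1 / t)"
      using t_pos by (intro mult_mono) (auto intro: power_le_one)
    thus ?thesis unfolding \<eta>_def by (simp add: divide_right_mono flip: divide_divide_eq_left)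
  qed
  have sum0: "(\<Sum>n<k. (1 / 2) ^ n * excess (dev h n)) \<ge> 0" by (intro sum_nonneg) auto
  have int0: "(\<integral>x. excess (height k h x) \<partial>circ) / t \<ge> 0" using t_pos by simp
  have "dev h n \<le> 29 + 1 / Suc k" if "n < k" for n
  proof -
    have "(1 / 2) ^ k * excess (dev h n) \<le> (1 / 2) ^ n * excess (dev h n)"
      using that by (intro mult_right_mono power_decreasing) auto
    also have "\<dots> \<le> (\<Sum>n<k. (1 / 2) ^ n * excess (dev h n))"
      using that by (intro member_le_sum) auto
    also have "\<dots> \<le> (1 / 2) ^ k * (1 / Suc k)" using h(2) \<eta>1 int0 unfolding total_excess_def by linarith
    finally have "excess (dev h n) \<le> 1 / Suc k" by (simp only: mult_le_cancel_left_pos zero_less_power half_gt_zero_iff zero_less_one)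
    thus ?thesis by (simp add: excess_def)
  qed
  moreover have "(\<integral>x. excess (height k h x) \<partial>circ) \<le> 1 / Suc k"
  proof -
    have "(\<integral>x. excess (height k h x) \<partial>circ) / t \<le> 1 / Suc k / t"
      using h(2) \<eta>2 sum0 unfolding total_excess_def by (simp add: mult.commute)
    thus ?thesis using t_pos by (simp only: divide_le_cancel)
  qed
  ultimately have "h \<in> near_solutions k"
    using L2_bound_of_penalty[OF h(1,3)] h(1) by (auto simp: near_solutions_def bounded_family_def)
  thus ?thesis by blast
qed

lemma integrable_height:
  assumes "\<And>n. h n \<in> H1"
  shows "integrable circ (height N h)" "integrable circ (\<lambda>x. excess (height N h x))"
proof -
  show i: "integrable circ (height N h)" unfolding height_def using H1_integrable[OF assms] by auto
  have [measurable]: "height N h \<in> borel_measurable circ" by (rule height_measurable[OF assms])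
  show "integrable circ (\<lambda>x. excess (height N h x))"
    by (rule Bochner_Integration.integrable_bound[OF i])
       (use excess_le height_nonneg in \<open>auto intro!: always_eventually\<close>)
qed

lemma near_solutions_antimono:
  assumes "k \<le> j"
  shows "near_solutions j \<subseteq> near_solutions k"
proof
  fix h assume h: "h \<in> near_solutions j"
  note D = near_solutionsD[OF h]
  have le: "1 / real (Suc j) \<le> 1 / real (Suc k)" using assms by (simp add: field_simps)
  have "height k h x \<le> height j h x" for x
    unfolding height_def using assms t_pos by (intro mult_left_mono sum_mono2) auto
  hence "(\<integral>x. excess (height k h x) \<partial>circ) \<le> (\<integral>x. excess (height j h x) \<partial>circ)"
    by (intro Bochner_Integration.integral_mono integrable_height D excess_mono)
  hence "(\<integral>x. excess (height k h x) \<partial>circ) \<le> 1 / Suc k" using D(5) le by linarith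
  moreover have "dev h n \<le> 29 + 1 / Suc k" if "n < k" for n
    using D(4)[of n] that assms le by linarith
  ultimately show "h \<in> near_solutions k" using D by (auto simp: near_solutions_def)
qed

text \<open>Every constraint is convex; midpoints are what the parallelogram law asks for.\<close>

lemma near_solutions_midpoint:
  assumes h: "h \<in> near_solutions k" and h': "h' \<in> near_solutions k"
  shows "(\<lambda>n x. (h n x + h' n x) / 2) \<in> near_solutions k"
proof -
  let ?m = "\<lambda>n x. (h n x + h' n x) / 2"
  note D = near_solutionsD[OF h] and D' = near_solutionsD[OF h']
  have m: "?m n \<in> H1" for n
    using H1_cmult[OF H1_add[OF D(1) D'(1)], of "1 / 2" n n] by simp
  have m2: "integrable circ (\<lambda>x. (norm (?m n x))\<^sup>2)" "(\<integral>x. (norm (?m n x))\<^sup>2 \<partial>circ) \<le> L2_bound" for n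
  proof -
    note P = integral_half_parallelogram[OF H1_measurable[OF D(1)] H1_measurable[OF D'(1)] D(2) D'(2), of n n]
    show "integrable circ (\<lambda>x. (norm (?m n x))\<^sup>2)" by (rule P)
    have "(\<integral>x. (norm ((h n x - h' n x) / 2))\<^sup>2 \<partial>circ) \<ge> 0" by simp
    moreover have "u \<le> L" if "u + v = (c + d) / 2" "0 \<le> v" "c \<le> L" "d \<le> L" for u v c d L :: real
      using that by argo
    ultimately show "(\<integral>x. (norm (?m n x))\<^sup>2 \<partial>circ) \<le> L2_bound" using P(3) D(3)[of n] D'(3)[of n] by blast
  qed
  have "dev ?m n \<le> 29 + 1 / Suc k" if "n < k" for n
  proof -
    have int: "integrable circ (\<lambda>x. norm (f n x - h n x))" "integrable circ (\<lambda>x. norm (f n x - h' n x))"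
      "integrable circ (\<lambda>x. norm (f n x - ?m n x))"
      using f_integrable H1_integrable[OF D(1)] H1_integrable[OF D'(1)] H1_integrable[OF m]
      by (auto simp del: integrable_norm_iff intro!: integrable_norm)
    have "dev ?m n \<le> (\<integral>x. (norm (f n x - h n x) + norm (f n x - h' n x)) / 2 \<partial>circ)"
      unfolding dev_def
    proof (rule Bochner_Integration.integral_mono)
      fix x
      have "f n x - ?m n x = ((f n x - h n x) + (f n x - h' n x)) / 2" by (simp add: field_simps)
      thus "norm (f n x - ?m n x) \<le> (norm (f n x - h n x) + norm (f n x - h' n x)) / 2"
        using norm_triangle_ineq[of "f n x - h n x" "f n x - h' n x"] by (simp only: norm_divide) simp
    qed (use int in auto)
    also have "\<dots> = (dev h n + dev h' n) / 2" using int by (simp add: dev_def)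
    finally show ?thesis using D(4)[OF that] D'(4)[OF that] by argo
  qed
  moreover have "(\<integral>x. excess (height k ?m x) \<partial>circ) \<le> 1 / Suc k"
  proof -
    have "(\<integral>x. excess (height k ?m x) \<partial>circ) \<le> (\<integral>x. (excess (height k h x) + excess (height k h' x)) / 2 \<partial>circ)"
    proof (rule Bochner_Integration.integral_mono)
      fix x
      have "(\<Sum>n<k. norm (?m n x)) \<le> (\<Sum>n<k. (norm (h n x) + norm (h' n x)) / 2)"
        by (intro sum_mono) (simp add: norm_divide norm_triangle_ineq)
      hence "height k ?m x \<le> t * (\<Sum>n<k. (norm (h n x) + norm (h' n x)) / 2)"
        unfolding height_def using t_pos by (intro mult_left_mono) auto
      also have "\<dots> = (height k h x + height k h' x) / 2"
        by (simp add: height_def sum.distrib distrib_left flip: sum_divide_distrib)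
      finally have "excess (height k ?m x) \<le> excess ((height k h x + height k h' x) / 2)"
        by (rule excess_mono)
      also have "\<dots> \<le> (excess (height k h x) + excess (height k h' x)) / 2"
        by (simp add: excess_def max_def field_simps)
      finally show "excess (height k ?m x) \<le> (excess (height k h x) + excess (height k h' x)) / 2" .
    qed (use integrable_height[OF D(1)] integrable_height[OF D'(1)] integrable_height[OF m] in auto)
    also have "\<dots> = ((\<integral>x. excess (height k h x) \<partial>circ) + (\<integral>x. excess (height k h' x) \<partial>circ)) / 2"
      using integrable_height[OF D(1)] integrable_height[OF D'(1)] by simp
    finally show ?thesis using D(5) D'(5) by argo
  qed
  ultimately show ?thesis using m m2 by (auto simp: near_solutions_def)
qed

text \<open>A squared Hilbert space norm for the whole sequence; the weights make it finite when the
  members are uniformly bounded in L^2.\<close>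

definition energy :: "(nat \<Rightarrow> real \<Rightarrow> complex) \<Rightarrow> real" where
  "energy h = (\<Sum>n. (1 / 2) ^ n * (\<integral>x. (norm (h n x))\<^sup>2 \<partial>circ))"

lemma energy_bounds:
  assumes "h \<in> near_solutions k"
  shows "0 \<le> energy h" "energy h \<le> 2 * L2_bound"
  using geometric_half_summable_bounded[OF _ near_solutionsD(3)[OF assms]]
  by (auto simp: energy_def intro!: suminf_nonneg)

text \<open>The parallelogram identities for all \<open>n\<close> are summed with the weights, and
  one term of the resulting nonnegative series is kept.\<close>

lemma energy_parallelogram:
  assumes h: "h \<in> near_solutions k" and h': "h' \<in> near_solutions k"
  shows "(1 / 2) ^ n * (\<integral>x. (norm ((h n x - h' n x) / 2))\<^sup>2 \<partial>circ)
      \<le> (energy h + energy h') / 2 - energy (\<lambda>n x. (h n x + h' n x) / 2)"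
proof -
  let ?m = "\<lambda>n x. (h n x + h' n x) / 2"
  let ?I = "\<lambda>h n. \<integral>x. (norm (h n x :: complex))\<^sup>2 \<partial>circ"
  let ?d = "\<lambda>n x. (h n x - h' n x) / 2"
  note D = near_solutionsD[OF h] and D' = near_solutionsD[OF h']
  have s: "summable (\<lambda>n. (1 / 2) ^ n * ?I k n)" if "k \<in> near_solutions j" for k j
    by (rule geometric_half_summable_bounded(1)[OF _ near_solutionsD(3)[OF that]]) simp
  note sums = s[OF h] s[OF h'] s[OF near_solutions_midpoint[OF h h']]
  have P: "?I ?d n = (?I h n + ?I h' n) / 2 - ?I ?m n" for n
    unfolding integral_half_parallelogram(3)[OF H1_measurable[OF D(1)] H1_measurable[OF D'(1)] D(2) D'(2),
      of n n, symmetric] by (rule add_diff_cancel_left'[symmetric])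
  have eq: "(1 / 2) ^ n * ?I ?d n =
     ((1 / 2) ^ n * ?I h n + (1 / 2) ^ n * ?I h' n) / 2 - (1 / 2) ^ n * ?I ?m n" for n
    unfolding P by (simp only: right_diff_distrib distrib_left times_divide_eq_right)
  have sd: "(\<lambda>n. (1 / 2) ^ n * ?I ?d n) sums ((energy h + energy h') / 2 - energy ?m)"
    unfolding eq energy_def
    by (intro sums_diff sums_divide sums_add summable_sums sums)
  have "(1 / 2) ^ n * ?I ?d n \<le> (\<Sum>n. (1 / 2) ^ n * ?I ?d n)"
    using sum_le_suminf[of "\<lambda>n. (1 / 2) ^ n * ?I ?d n" "{n}"] sums_summable[OF sd] by simp
  thus ?thesis using sums_unique[OF sd] by simp
qed

text \<open>Projection onto nested convex sets. The infima \<open>q k\<close> increase and are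
  bounded, hence converge. For \<open>k \<le> j\<close> the midpoint of \<open>h j\<close> and
  \<open>h k\<close> lies in \<open>near_solutions k\<close>, so its energy is at least
  \<open>q k\<close>, and the parallelogram law bounds the distance by \<open>q j - q k\<close> and
  the tolerances. Each coordinate thus converges strongly, without weak compactness.\<close>

lemma near_solutions_Cauchy:
  obtains h where "\<And>k. h k \<in> near_solutions k"
    "\<And>n e. e > 0 \<Longrightarrow> \<exists>K. \<forall>i\<ge>K. \<forall>j\<ge>K. (\<integral>x. norm (h i n x - h j n x) \<partial>circ) < e"
proof -
  define q where "q k = Inf (energy ` near_solutions k)" for k
  have bdd: "bdd_below (energy ` near_solutions k)" for k
    using energy_bounds(1) by (intro bdd_belowI[of _ 0]) auto
  have q_le: "q k \<le> energy h" if "h \<in> near_solutions k" for h k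
    unfolding q_def using that bdd by (intro cInf_lower) auto
  have "\<exists>h\<in>near_solutions k. energy h < q k + 1 / Suc k" for k
  proof -
    have "Inf (energy ` near_solutions k) < q k + 1 / Suc k" by (simp add: q_def)
    thus ?thesis using cInf_lessD[of "energy ` near_solutions k"] near_solutions_nonempty by blast
  qed
  then obtain h where h: "\<And>k. h k \<in> near_solutions k" "\<And>k. energy (h k) < q k + 1 / Suc k"
    by metis
  have "incseq q"
    unfolding q_def
    by (intro incseq_SucI cInf_superset_mono bdd image_mono near_solutions_antimono)
       (use near_solutions_nonempty in auto)
  moreover have "q k \<le> 2 * L2_bound" for k
    using q_le[OF h(1)] energy_bounds(2)[OF h(1)] order_trans by blast
  ultimately have "convergent q" using incseq_convergent[of q] convergent_def by blast
  hence cq: "Cauchy q" by (rule convergent_Cauchy)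
  have est: "(1 / 2) ^ n * (\<integral>x. (norm ((h j n x - h k n x) / 2))\<^sup>2 \<partial>circ) \<le> (q j - q k) / 2 + 1 / Suc k"
    if "k \<le> j" for j k n
  proof -
    have hj: "h j \<in> near_solutions k" using h(1)[of j] near_solutions_antimono[OF that] by blast
    have "(1 / 2) ^ n * (\<integral>x. (norm ((h j n x - h k n x) / 2))\<^sup>2 \<partial>circ)
      \<le> (energy (h j) + energy (h k)) / 2 - energy (\<lambda>n x. (h j n x + h k n x) / 2)"
      by (rule energy_parallelogram[OF hj h(1)])
    moreover have "q k \<le> energy (\<lambda>n x. (h j n x + h k n x) / 2)"
      by (intro q_le near_solutions_midpoint hj h)
    moreover have "1 / real (Suc j) \<le> 1 / real (Suc k)" using that by (simp add: field_simps)
    ultimately show ?thesis using h(2)[of j] h(2)[of k] by argo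
  qed
  have L1: "(\<integral>x. norm (h j n x - h k n x) \<partial>circ)\<^sup>2 \<le> 4 * 2 ^ n * ((q j - q k) / 2 + 1 / Suc k)"
    if "k \<le> j" for j k n
  proof -
    note D = near_solutionsD[OF h(1)]
    note P = integral_half_parallelogram(2)[OF H1_measurable[OF D(1)] H1_measurable[OF D(1)] D(2) D(2), of j n k n]
    have [measurable]: "h k n \<in> borel_measurable circ" for k n using H1_measurable[OF D(1)] .
    have e: "(norm ((h j n x - h k n x) / 2))\<^sup>2 = (norm (h j n x - h k n x))\<^sup>2 / 4" for x
      by (simp add: norm_divide power_divide)
    have "integrable circ (\<lambda>x. 4 * (norm ((h j n x - h k n x) / 2))\<^sup>2)"
      using P by (intro integrable_mult_right)
    hence "integrable circ (\<lambda>x. (norm (h j n x - h k n x))\<^sup>2)" unfolding e by simp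
    hence "(\<integral>x. norm (h j n x - h k n x) \<partial>circ)\<^sup>2 \<le> (\<integral>x. (norm (h j n x - h k n x))\<^sup>2 \<partial>circ)"
      by (intro circ_L2_imp_L1(2)) auto
    also have "\<dots> = 4 * 2 ^ n * ((1 / 2) ^ n * (\<integral>x. (norm ((h j n x - h k n x) / 2))\<^sup>2 \<partial>circ))"
      unfolding e by (simp add: power_divide)
    also have "\<dots> \<le> 4 * 2 ^ n * ((q j - q k) / 2 + 1 / Suc k)"
      by (intro mult_left_mono est that) auto
    finally show ?thesis .
  qed
  have "\<exists>K. \<forall>i\<ge>K. \<forall>j\<ge>K. (\<integral>x. norm (h i n x - h j n x) \<partial>circ) < e" if e: "e > 0" for n e
  proof -
    \<comment> \<open>Offsets the factor \<open>4 * 2 ^ n\<close> in the fact \<open>L1\<close>: the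
      power comes from the weight in the energy, the 4 from halving the difference.\<close>
    define \<eta> where "\<eta> = e\<^sup>2 / (4 * 2 ^ n)"
    have \<eta>: "\<eta> > 0" using e by (simp add: \<eta>_def)
    obtain K1 where K1: "\<And>i j. i \<ge> K1 \<Longrightarrow> j \<ge> K1 \<Longrightarrow> \<bar>q i - q j\<bar> < \<eta>"
      using cq \<eta> unfolding Cauchy_def dist_real_def by meson
    obtain K2 where K2: "inverse (real (Suc K2)) < \<eta> / 2"
      using reals_Archimedean[of "\<eta> / 2"] \<eta> by auto
    have ord: "(\<integral>x. norm (h j n x - h k n x) \<partial>circ) < e" if "k \<ge> max K1 K2" "k \<le> j" for j k
    proof -
      have "1 / real (Suc k) \<le> 1 / real (Suc K2)" using that by (simp add: field_simps)
      hence "1 / real (Suc k) < \<eta> / 2" using K2 by (simp add: inverse_eq_divide)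
      moreover have "q j - q k < \<eta>" using K1[of j k] that by auto
      ultimately have "(q j - q k) / 2 + 1 / Suc k < \<eta>" by argo
      hence "4 * 2 ^ n * ((q j - q k) / 2 + 1 / Suc k) < 4 * 2 ^ n * \<eta>"
        by (intro mult_strict_left_mono) auto
      also have "\<dots> = e\<^sup>2" by (simp add: \<eta>_def)
      finally have "(\<integral>x. norm (h j n x - h k n x) \<partial>circ)\<^sup>2 < e\<^sup>2" using L1[OF that(2), of n] by linarith
      thus ?thesis using e by (simp add: power2_less_imp_less)
    qed
    have "(\<integral>x. norm (h i n x - h j n x) \<partial>circ) < e" if "i \<ge> max K1 K2" "j \<ge> max K1 K2" for i j
    proof (cases "i \<le> j")
      case True
      thus ?thesis using ord[OF that(1) True] by (simp add: norm_minus_commute)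
    qed (use ord[OF that(2), of i] in auto)
    thus ?thesis by blast
  qed
  thus ?thesis using that h(1) by blast
qed

text \<open>L^1 convergence of each coordinate suffices: \<open>dev\<close> changes by at most the
  L^1 distance, and \<open>excess\<close> is 1-Lipschitz. For fixed \<open>n\<close> and
  \<open>N\<close> the constraints are in force as soon as \<open>k > n\<close> and
  \<open>k \<ge> N\<close>, with tolerance tending to 0.\<close>

lemma exists_solution:
  obtains h where "\<And>n. h n \<in> H1" "\<And>n. dev h n \<le> 29" "\<And>N. AE x in circ. height N h x \<le> 29"
proof -
  obtain s where s: "\<And>k. s k \<in> near_solutions k"
    and cau: "\<And>n e. e > 0 \<Longrightarrow> \<exists>K. \<forall>i\<ge>K. \<forall>j\<ge>K. (\<integral>x. norm (s i n x - s j n x) \<partial>circ) < e"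
    using near_solutions_Cauchy by blast
  note D = near_solutionsD[OF s]
  have int_s: "integrable circ (s k n)" for k n using H1_integrable[OF D(1)] .
  have "\<forall>n. \<exists>g. integrable circ g \<and> (\<lambda>k. \<integral>x. norm (s k n x - g x) \<partial>circ) \<longlonglongrightarrow> 0"
    using L1_Cauchy_limit[OF int_s cau] by metis
  then obtain h where h: "\<And>n. integrable circ (h n)"
    "\<And>n. (\<lambda>k. \<integral>x. norm (s k n x - h n x) \<partial>circ) \<longlonglongrightarrow> 0" by metis
  have hH1: "h n \<in> H1" for n by (rule H1_L1_limit[OF D(1) h])
  have inv0: "(\<lambda>k. 1 / real (Suc k)) \<longlonglongrightarrow> 0"
    using LIMSEQ_inverse_real_of_nat by (simp add: inverse_eq_divide)
  have "dev h n \<le> 29" for n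
  proof (rule LIMSEQ_le_const)
    show "(\<lambda>k. 29 + 1 / real (Suc k) + (\<integral>x. norm (s k n x - h n x) \<partial>circ)) \<longlonglongrightarrow> 29"
      using tendsto_add[OF tendsto_add[OF tendsto_const inv0] h(2)[of n], of 29] by simp
    have "dev h n \<le> 29 + 1 / real (Suc k) + (\<integral>x. norm (s k n x - h n x) \<partial>circ)" if "k > n" for k
    proof -
      have "dev h n \<le> (\<integral>x. norm (f n x - s k n x) + norm (s k n x - h n x) \<partial>circ)"
        unfolding dev_def
      proof (rule Bochner_Integration.integral_mono)
        show "norm (f n x - h n x) \<le> norm (f n x - s k n x) + norm (s k n x - h n x)" for x
          using norm_triangle_ineq[of "f n x - s k n x" "s k n x - h n x"] by simp
      qed (use f_integrable int_s h in auto)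
      also have "\<dots> = dev (s k) n + (\<integral>x. norm (s k n x - h n x) \<partial>circ)"
        unfolding dev_def by (rule Bochner_Integration.integral_add) (use f_integrable int_s h in auto)
      finally show ?thesis using D(4)[OF that] by simp
    qed
    thus "\<exists>K. \<forall>k\<ge>K. dev h n \<le> 29 + 1 / real (Suc k) + (\<integral>x. norm (s k n x - h n x) \<partial>circ)"
      by (intro exI[of _ "Suc n"]) auto
  qed
  moreover have "AE x in circ. height N h x \<le> 29" for N
  proof -
    note ih = integrable_height[OF hH1, of N]
    have "(\<integral>x. excess (height N h x) \<partial>circ) \<le> 0"
    proof (rule LIMSEQ_le_const)
      show "(\<lambda>k. 1 / real (Suc k) + t * (\<Sum>n<N. \<integral>x. norm (s k n x - h n x) \<partial>circ)) \<longlonglongrightarrow> 0"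
      proof -
        have "(\<lambda>k. 1 / real (Suc k) + t * (\<Sum>n<N. \<integral>x. norm (s k n x - h n x) \<partial>circ)) \<longlonglongrightarrow> 0 + t * (\<Sum>n<N. 0)"
          by (intro tendsto_intros inv0 h(2))
        thus ?thesis by simp
      qed
      have "(\<integral>x. excess (height N h x) \<partial>circ) \<le> 1 / real (Suc k) + t * (\<Sum>n<N. \<integral>x. norm (s k n x - h n x) \<partial>circ)"
        if "k \<ge> N" for k
      proof -
        note int_h = integrable_height[where h = "s k" and N = k, OF D(1)]
        have id: "integrable circ (\<lambda>x. norm (s k n x - h n x))" for n using int_s h by auto
        have "(\<integral>x. excess (height N h x) \<partial>circ) \<le>
            (\<integral>x. excess (height k (s k) x) + t * (\<Sum>n<N. norm (s k n x - h n x)) \<partial>circ)"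
        proof (rule Bochner_Integration.integral_mono)
          fix x
          have "(\<Sum>n<N. norm (h n x)) \<le> (\<Sum>n<N. norm (s k n x) + norm (s k n x - h n x))"
          proof (rule sum_mono)
            show "norm (h n x) \<le> norm (s k n x) + norm (s k n x - h n x)" for n
              using norm_triangle_sub[of "h n x" "s k n x"] by (simp add: norm_minus_commute)
          qed
          also have "\<dots> \<le> (\<Sum>n<k. norm (s k n x)) + (\<Sum>n<N. norm (s k n x - h n x))"
            unfolding sum.distrib using that by (intro add_mono sum_mono2) auto
          finally have "height N h x \<le> height k (s k) x + t * (\<Sum>n<N. norm (s k n x - h n x))"
            unfolding height_def using t_pos by (simp flip: distrib_left)
          hence "excess (height N h x) \<le> excess (height k (s k) x + t * (\<Sum>n<N. norm (s k n x - h n x)))"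
            by (rule excess_mono)
          also have "\<dots> \<le> excess (height k (s k) x) + \<bar>t * (\<Sum>n<N. norm (s k n x - h n x))\<bar>"
            by (rule excess_add_le)
          also have "\<bar>t * (\<Sum>n<N. norm (s k n x - h n x))\<bar> = t * (\<Sum>n<N. norm (s k n x - h n x))"
            using t_pos by (intro abs_of_nonneg mult_nonneg_nonneg sum_nonneg) auto
          finally show "excess (height N h x) \<le> excess (height k (s k) x) + t * (\<Sum>n<N. norm (s k n x - h n x))" .
        qed (use ih int_h id in auto)
        also have "\<dots> = (\<integral>x. excess (height k (s k) x) \<partial>circ) + t * (\<Sum>n<N. \<integral>x. norm (s k n x - h n x) \<partial>circ)"
          using int_h id by simp
        finally show ?thesis using D(5)[of k] by simp
      qed
      thus "\<exists>K. \<forall>k\<ge>K. (\<integral>x. excess (height N h x) \<partial>circ) \<le>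
          1 / real (Suc k) + t * (\<Sum>n<N. \<integral>x. norm (s k n x - h n x) \<partial>circ)" by blast
    qed
    moreover have "(\<integral>x. excess (height N h x) \<partial>circ) \<ge> 0" by simp
    ultimately have "(\<integral>x. excess (height N h x) \<partial>circ) = 0" by linarith
    hence "AE x in circ. excess (height N h x) = 0"
      using integral_nonneg_eq_0_iff_AE[OF ih(2)] by simp
    thus ?thesis by eventually_elim (simp add: excess_def max_def split: if_splits)
  qed
  ultimately show ?thesis using that hH1 by blast
qed

section \<open>From partial sums to the full series\<close>

lemma H1_decomposition:
  "\<exists>g h. (\<forall>n. g n \<in> H1 \<and> h n \<in> Hinf \<and> (AE x in circ. f n x = g n x + h n x))
         \<and> (\<forall>n. H1_norm (g n) \<le> 29)
         \<and> (AE x in circ. (\<Sum>n. ennreal (norm (h n x))) \<le> ennreal (29 / t))"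
proof -
  obtain h where h: "\<And>n. h n \<in> H1" "\<And>n. dev h n \<le> 29" "\<And>N. AE x in circ. height N h x \<le> 29"
    using exists_solution by blast
  define g where "g n x = f n x - h n x" for n x
  have "g n \<in> H1" for n unfolding g_def by (intro H1_diff f_H1 h)
  moreover have "H1_norm (g n) \<le> 29" for n using h(2)[of n] by (simp add: H1_norm_def g_def dev_def)
  \<comment> \<open>There are countably many \<open>N\<close>, so one null set serves all partial
    sums and hence the series.\<close>
  moreover have all: "AE x in circ. \<forall>N. height N h x \<le> 29" using h(3) by (simp add: AE_all_countable)
  have "h n \<in> Hinf" for n
  proof -
    have "AE x in circ. norm (h n x) \<le> 29 / t"
      \<comment> \<open>\<open>Suc n\<close> gives the first partial sum that contains the index
        \<open>n\<close>.\<close>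
      using h(3)[of "Suc n"]
    proof eventually_elim
      case (elim x)
      have "t * norm (h n x) \<le> height (Suc n) h x"
        unfolding height_def using t_pos by (intro mult_left_mono member_le_sum) auto
      thus ?case using elim t_pos by (simp add: field_simps)
    qed
    thus ?thesis using h(1) by (auto simp: Hinf_iff)
  qed
  moreover have "AE x in circ. (\<Sum>n. ennreal (norm (h n x))) \<le> ennreal (29 / t)"
    using all
  proof eventually_elim
    case (elim x)
    show ?case
    proof (rule suminf_le_const)
      fix N
      have "(\<Sum>n<N. norm (h n x)) \<le> 29 / t"
        using elim[rule_format, of N] t_pos by (simp add: height_def field_simps)
      thus "(\<Sum>n<N. ennreal (norm (h n x))) \<le> ennreal (29 / t)" by (simp add: ennreal_leI)
    qed simp
  qed
  ultimately show ?thesis by (intro exI[of _ g] exI[of _ h]) (auto simp: g_def)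
qed

end

theorem theorem4p3:
  shows "\<exists>C::real. \<forall>(f :: nat \<Rightarrow> real \<Rightarrow> complex) (t::real).
    (\<forall>n. f n \<in> H1) \<longrightarrow> t > 0 \<longrightarrow>
    (\<forall>E F. finite E \<longrightarrow> F \<in> sets circ \<longrightarrow>
        (\<Sum>n\<in>E. (\<integral>x\<in>F. norm (f n x) \<partial>circ)) \<le> max (real (card E)) (measure circ F / t)) \<longrightarrow>
    (\<exists>g h. (\<forall>n. g n \<in> H1 \<and> h n \<in> Hinf \<and> (AE x in circ. f n x = g n x + h n x))
         \<and> (\<forall>n. H1_norm (g n) \<le> C)
         \<and> (AE x in circ. (\<Sum>n. ennreal (norm (h n x))) \<le> ennreal (C / t)))"
proof (intro exI[of _ 29] allI impI)
  fix f :: "nat \<Rightarrow> real \<Rightarrow> complex" and t :: real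
  assume "\<forall>n. f n \<in> H1" "t > 0"
    "\<forall>E F. finite E \<longrightarrow> F \<in> sets circ \<longrightarrow>
        (\<Sum>n\<in>E. (\<integral>x\<in>F. norm (f n x) \<partial>circ)) \<le> max (real (card E)) (measure circ F / t)"
  then interpret bounded_H1_sequence f t by unfold_locales auto
  show "\<exists>g h. (\<forall>n. g n \<in> H1 \<and> h n \<in> Hinf \<and> (AE x in circ. f n x = g n x + h n x))
         \<and> (\<forall>n. H1_norm (g n) \<le> 29)
         \<and> (AE x in circ. (\<Sum>n. ennreal (norm (h n x))) \<le> ennreal (29 / t))"
    by (rule H1_decomposition)
qed

end
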